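(* Let $2\le s\le s^\star$ with $\|\mathcal A\|_{s^\star}<\infty$, and let $T$, $\bar x$ be as in the context. Let $M\ge1$ be an integer. Suppose that for $k=0,\dots,M-1$ and $r>0$ there are $Y_k, Z_k(r)\in Mat(n,\mathbb R)^2$ with $$|(T(\bar x)-\bar x)_k|\le_{cw}Y_k,\qquad \sup_{b_1,b_2\in B(r)}\big|[DT(\bar x+b_1)b_2]_k\big|\le_{cw}Z_k(r),\qquad k=0,\dots,M-1,$$ and that there are real numbers $\widehat Y_M,\widehat Z_M(r)$ with $$|(T(\bar x)-\bar x)_k|_\infty\le\frac{M^s}{k^s}\widehat Y_M,\qquad \sup_{b_1,b_2\in B(r)}\big|[DT(\bar x+b_1)b_2]_k\big|_\infty\le\frac{M^s}{k^s}\widehat Z_M(r),\qquad\forall k\ge M.$$ For $k\geq M$ define $$Y_k:=\frac{M^s}{k^s}\widehat Y_M\,[\mathds 1_n,\mathds 1_n],\qquad Z_k(r):=\frac{M^s}{k^s}\widehat Z_M(r)\,[\mathds 1_n,\mathds 1_n].$$ Define the radii polynomials $$p_k(r):=Y_k+Z_k(r)-\frac{r}{w_k^s}(\mathds 1_n,\mathds 1_n),\quad k=0,\dots,M-1,\qquad p_M(r):=\widehat Y_M+\widehat Z_M(r)-\frac{r}{w_M^s}.$$ If there exists $r>0$ such that $p_k(r)<_{cw}0$ for all $k=0,\dots,M$, then there exists a unique $x^*\in B_{\bar x}(r)$ such that $T(x^* )=x^*$ and $f(x^* )=0$.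
   Context: Setting. Fix $n\ge1$, $\tau>0$ and a $\tau$-periodic real $n\times n$ matrix function $A(t)$, expanded as a $2\tau$-periodic function, $A(t)=\sum_{k\in\mathbb Z}\mathcal A_ke^{ik\frac{2\pi}{2\tau}t}$, with $\mathcal A_0\in Mat(n,\mathbb R)$, $\mathcal A_k\in Mat(n,\mathbb C)$ and $\mathcal A_{-k}$ the entrywise complex conjugate of $\mathcal A_k$ ($\mathcal A_k=0$ for odd $k$). Notation. For a matrix $B=\{b_{ij}\}$, $|B|=\{|b_{ij}|\}$ and $|B|_\infty=\max_{i,j}|b_{ij}|$; for a tuple of matrices $|\cdot|$ acts on each entry and $|\cdot|_\infty$ is the maximum of the $|\cdot|_\infty$ of its entries. $\le_{cw}$, $<_{cw}$ are entrywise inequalities (also for tuples of matrices, and for comparison with a scalar). Suprema of matrices are entrywise. $\|B\|_\infty=\max_i\sum_j|b_{ij}|$. $\mathds 1_n$ is the $n\times n$ matrix with all entries $1$. $w_k=|k|$ for $k\ne0$, $w_0=1$. $\|\mathcal A\|_s=\sup_{k\ge0}|\mathcal A_k|_\infty w_k^s$. Spaces. $X$ is the space of sequences $x=(x_0,x_1,x_2,\dots)$ with $x_0=(R,Q_0)\in Mat(n,\mathbb R)^2$ and $x_k=Q_k=(Q_{k,1},Q_{k,2})\in Mat(n,\mathbb R)^2$ for $k\ge1$. $\|x\|_s=\sup_{k\ge0}|x_k|_\infty w_k^s$ and $\Omega^s=\{x\in X:\|x\|_s<\infty\}$, a Banach space. The map $f$. Put $Q_{0,1}=Q_0$, $Q_{0,2}=0$,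 $Q_{-k,1}=Q_{k,1}$, $Q_{-k,2}=-Q_{k,2}$, $(\mathcal A\cdot Q)_k=\sum_{k_1+k_2=k}\mathcal A_{k_1}(Q_{k_2,1}+iQ_{k_2,2})$ (sum over $k_1,k_2\in\mathbb Z$), with real and imaginary parts $(\mathcal A\cdot Q)_{k,1}$, $(\mathcal A\cdot Q)_{k,2}$. Then $f(x)=((f_\star,f_0),f_1,f_2,\dots)$ where $f_\star=Q_0+2\sum_{k\ge1}Q_{k,1}-I$, $f_0=Q_0R-(\mathcal A\cdot Q)_0$, and for $k\ge1$, $f_k=(f_{k,1},f_{k,2})$ with $f_{k,1}=-k\frac{2\pi}{2\tau}Q_{k,2}+Q_{k,1}R-(\mathcal A\cdot Q)_{k,1}$, $f_{k,2}=k\frac{2\pi}{2\tau}Q_{k,1}+Q_{k,2}R-(\mathcal A\cdot Q)_{k,2}$. The operator $T$. Fix an integer $m>1$ and a point $\bar x=(\bar R,\bar Q_0,\dots,\bar Q_{m-1},0,0,\dots)\in X$ (in practice an approximate zero of the truncation of $f$ to its first $m$ components). Identify $Mat(n,\mathbb R)^2$ with $\mathbb R^{2n^2}$, and $(Mat(n,\mathbb R)^{2})^m$ with $\mathbb R^{2n^2m}$. Let $A_m\in Mat(2n^2m,\mathbb R)$ be an invertible matrix (in practice a numerical approximation of the inverse of the Jacobian at $\bar x$ of the truncated map $x^m\mapsto(f_\star,f_0,\dots,f_{m-1})(x^m,0,0,\dots)$). For $k\ge m$ let $\Lambda_k=\frac{\partial f_k}{\partial Q_k}(\bar x)\in Mat(2n^2,\mathbb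 R)$. It is assumed that $m>K$, where $K$ and a constant $C_\Lambda$ are such that for all $k\ge K$, $\Lambda_k$ is invertible with $\|\Lambda_k^{-1}\|_\infty<C_\Lambda/k$ (such $K,C_\Lambda$ exist). Define the linear operator $A$ on $X$ by $(Ax)_k=(A_mx^m)_k$ for $k=0,\dots,m-1$, where $x^m=(x_0,\dots,x_{m-1})$, and $(Ax)_k=\Lambda_k^{-1}x_k$ for $k\ge m$. Then $T(x)=x-Af(x)$, which maps $\Omega^s$ to $\Omega^s$, and $DT$ is its derivative. Balls. $B(r)$ is the closed ball of radius $r$ in $\Omega^s$ centered at $0$ and $B_{\bar x}(r)=\bar x+B(r)$. *)

theory Defs
  imports "HOL-Analysis.Analysis"
begin

text \<open>
  \<open>'n\<close> indexes rows and columns of the \<open>n \<times> n\<close> matrices, so \<open>n = CARD('n) \<ge> 1\<close>.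
  A sequence \<open>x\<close> in \<open>X\<close> has \<open>x 0 = (R, Q\<^sub>0)\<close> and \<open>x k = (Q\<^sub>k\<^sub>,\<^sub>1, Q\<^sub>k\<^sub>,\<^sub>2)\<close> for \<open>k \<ge> 1\<close>.
\<close>

type_synonym 'n mat2 = "(real^'n^'n) \<times> (real^'n^'n)"
type_synonym 'n seqX = "nat \<Rightarrow> 'n mat2"


section \<open>Entrywise order and norms\<close>

text \<open>
  The library order \<open><\<close> on vectors and pairs is \<open>x \<le> y \<and> \<not> y \<le> x\<close>, which is not the entrywise
  strict order; hence explicit relations here.
\<close>

definition cw_le :: "(('a::ord)^'n^'n) \<times> ('a^'n^'n) \<Rightarrow> ('a^'n^'n) \<times> ('a^'n^'n) \<Rightarrow> bool" where
  "cw_le P Q \<longleftrightarrow> (\<forall>i j. fst P $ i $ j \<le> fst Q $ i $ j \<and> snd P $ i $ j \<le> snd Q $ i $ j)"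

definition cw_less :: "(('a::ord)^'n^'n) \<times> ('a^'n^'n) \<Rightarrow> ('a^'n^'n) \<times> ('a^'n^'n) \<Rightarrow> bool" where
  "cw_less P Q \<longleftrightarrow> (\<forall>i j. fst P $ i $ j < fst Q $ i $ j \<and> snd P $ i $ j < snd Q $ i $ j)"

definition cw_abs :: "('n::finite) mat2 \<Rightarrow> 'n mat2" where
  "cw_abs P = (map_matrix abs (fst P), map_matrix abs (snd P))"

definition ereal_mat2 :: "('n::finite) mat2 \<Rightarrow> (ereal^'n^'n) \<times> (ereal^'n^'n)" where
  "ereal_mat2 P = (map_matrix ereal (fst P), map_matrix ereal (snd P))"

text \<open>Suprema are taken in the extended reals, so that an unbounded set has supremum \<open>\<infinity>\<close>.\<close>

definition cw_Sup :: "('n::finite) mat2 set \<Rightarrow> (ereal^'n^'n) \<times> (ereal^'n^'n)" where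
  "cw_Sup S = ((\<chi> i j. SUP P\<in>S. ereal (fst P $ i $ j)), (\<chi> i j. SUP P\<in>S. ereal (snd P $ i $ j)))"

definition ones :: "real^'n^'n" where
  "ones = (\<chi> i j. 1)"

definition mat_max :: "('a::real_normed_vector)^'n^'n \<Rightarrow> real" where
  "mat_max B = Max (range (\<lambda>(i, j). norm (B $ i $ j)))"

definition mat2_max :: "('n::finite) mat2 \<Rightarrow> real" where
  "mat2_max P = max (mat_max (fst P)) (mat_max (snd P))"

definition row_sum_norm :: "real^'i^'i \<Rightarrow> real" where
  "row_sum_norm B = Max (range (\<lambda>i. \<Sum>j\<in>UNIV. \<bar>B $ i $ j\<bar>))"

definition wt :: "nat \<Rightarrow> real" where
  "wt k = (if k = 0 then 1 else real k)"

definition coeff_norm :: "real \<Rightarrow> (int \<Rightarrow> complex^'n^'n) \<Rightarrow> ereal" where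
  "coeff_norm s a = (SUP k::nat. ereal (mat_max (a (int k)) * wt k powr s))"

definition seq_norm :: "real \<Rightarrow> ('n::finite) seqX \<Rightarrow> ereal" where
  "seq_norm s x = (SUP k. ereal (mat2_max (x k) * wt k powr s))"

definition Omega :: "real \<Rightarrow> ('n::finite) seqX set" where
  "Omega s = {x. seq_norm s x < \<infinity>}"

definition ball0 :: "real \<Rightarrow> real \<Rightarrow> ('n::finite) seqX set" where
  "ball0 s r = {x \<in> Omega s. seq_norm s x \<le> ereal r}"

definition ball_at :: "real \<Rightarrow> ('n::finite) seqX \<Rightarrow> real \<Rightarrow> 'n seqX set" where
  "ball_at s c r = {(\<lambda>k. c k + b k) | b. b \<in> ball0 s r}"


section \<open>Frechet derivatives on \<open>\<Omega>\<^sup>s\<close>\<close>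

text \<open>
  The space depends on the real parameter \<open>s\<close> and is a proper subset of the type of all sequences,
  so the type-class based \<^const>\<open>has_derivative\<close> does not apply.
\<close>

definition has_Omega_derivative ::
    "real \<Rightarrow> (('n::finite) seqX \<Rightarrow> 'n seqX) \<Rightarrow> ('n seqX \<Rightarrow> 'n seqX) \<Rightarrow> 'n seqX \<Rightarrow> bool" where
  "has_Omega_derivative s F D x \<longleftrightarrow>
     (\<forall>g\<in>Omega s. \<forall>h\<in>Omega s. D (\<lambda>k. g k + h k) = (\<lambda>k. D g k + D h k)) \<and>
     (\<forall>c. \<forall>h\<in>Omega s. D (\<lambda>k. c *\<^sub>R h k) = (\<lambda>k. c *\<^sub>R D h k)) \<and>
     (\<exists>C::real. \<forall>h\<in>Omega s. seq_norm s (D h) \<le> ereal C * seq_norm s h) \<and>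
     (\<forall>\<epsilon>::real. \<epsilon> > 0 \<longrightarrow> (\<exists>\<delta>::real. \<delta> > 0 \<and> (\<forall>h\<in>Omega s. seq_norm s h < ereal \<delta> \<longrightarrow>
        seq_norm s (\<lambda>k. F (\<lambda>l. x l + h l) k - F x k - D h k) \<le> ereal \<epsilon> * seq_norm s h)))"

text \<open>Analogue of \<^const>\<open>frechet_derivative\<close>; the values on \<open>\<Omega>\<^sup>s\<close> do not depend on the choice.\<close>

definition Omega_derivative :: "real \<Rightarrow> (('n::finite) seqX \<Rightarrow> 'n seqX) \<Rightarrow> 'n seqX \<Rightarrow> 'n seqX \<Rightarrow> 'n seqX" where
  "Omega_derivative s F x = (SOME D. has_Omega_derivative s F D x)"


section \<open>The map \<open>f\<close>\<close>

text \<open>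
  The coefficients of the expansion of a \<open>\<tau>\<close>-periodic real matrix function as a
  \<open>2\<tau>\<close>-periodic function.
\<close>

definition fourier_coeffs :: "real \<Rightarrow> (real \<Rightarrow> real^'n^'n) \<Rightarrow> (int \<Rightarrow> complex^'n^'n) \<Rightarrow> bool" where
  "fourier_coeffs \<tau> At a \<longleftrightarrow>
     (\<forall>t. ((\<lambda>k. map_matrix (\<lambda>z. z * exp (\<i> * of_int k * of_real (2 * pi / (2 * \<tau>)) * of_real t)) (a k))
              has_sum map_matrix of_real (At t)) UNIV) \<and>
     (\<forall>i j. a 0 $ i $ j \<in> \<real>) \<and>
     (\<forall>k. a (- k) = map_matrix cnj (a k)) \<and>
     (\<forall>k. odd k \<longrightarrow> a k = 0)"

text \<open>\<open>Q\<^sub>k\<^sub>,\<^sub>1\<close> and \<open>Q\<^sub>k\<^sub>,\<^sub>2\<close> for all integers \<open>k\<close>.\<close>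

definition Q1 :: "('n::finite) seqX \<Rightarrow> int \<Rightarrow> real^'n^'n" where
  "Q1 x k = (if k = 0 then snd (x 0) else fst (x (nat \<bar>k\<bar>)))"

definition Q2 :: "('n::finite) seqX \<Rightarrow> int \<Rightarrow> real^'n^'n" where
  "Q2 x k = (if k = 0 then 0 else if k > 0 then snd (x (nat k)) else - snd (x (nat (- k))))"

definition QC :: "('n::finite) seqX \<Rightarrow> int \<Rightarrow> complex^'n^'n" where
  "QC x k = (\<chi> i j. of_real (Q1 x k $ i $ j) + \<i> * of_real (Q2 x k $ i $ j))"

definition conv :: "(int \<Rightarrow> complex^'n^'n) \<Rightarrow> 'n seqX \<Rightarrow> int \<Rightarrow> complex^'n^'n" where
  "conv a x k = (\<Sum>\<^sub>\<infinity>(k1, k2)\<in>{(k1, k2). k1 + k2 = k}. a k1 ** QC x k2)"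

text \<open>
  In the component \<open>f\<^sub>0\<close> the real part of \<open>conv a x 0\<close> is the whole of it, by the conjugation
  symmetry of the coefficients.
\<close>

definition fmap :: "real \<Rightarrow> (int \<Rightarrow> complex^'n^'n) \<Rightarrow> 'n seqX \<Rightarrow> 'n seqX" where
  "fmap \<tau> a x k =
    (let R = fst (x 0); Q0 = snd (x 0) in
     if k = 0 then
       (Q0 + 2 *\<^sub>R (\<Sum>\<^sub>\<infinity>l\<in>{1..}. fst (x l)) - mat 1,
        Q0 ** R - map_matrix Re (conv a x 0))
     else
       (- (real k * (2 * pi / (2 * \<tau>))) *\<^sub>R snd (x k) + fst (x k) ** R
          - map_matrix Re (conv a x (int k)),
        (real k * (2 * pi / (2 * \<tau>))) *\<^sub>R fst (x k) + snd (x k) ** R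
          - map_matrix Im (conv a x (int k))))"


section \<open>The operators \<open>A\<close> and \<open>T\<close>\<close>

text \<open>The identification of \<open>Mat(n,\<real>)\<^sup>2\<close> with \<open>\<real>\<close> to the power \<open>2n\<^sup>2\<close>.\<close>

type_synonym 'n idx = "'n \<times> 'n + 'n \<times> 'n"

definition vec_of :: "'n mat2 \<Rightarrow> real^('n::finite idx)" where
  "vec_of P = (\<chi> c. case c of Inl (i, j) \<Rightarrow> fst P $ i $ j | Inr (i, j) \<Rightarrow> snd P $ i $ j)"

definition mat2_of :: "real^('n::finite idx) \<Rightarrow> 'n mat2" where
  "mat2_of v = ((\<chi> i j. v $ Inl (i, j)), (\<chi> i j. v $ Inr (i, j)))"

text \<open>
  A real square matrix of size \<open>2n\<^sup>2m\<close> is given by its \<open>m \<times> m\<close> blocks of size \<open>2n\<^sup>2\<close>; only the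
  blocks with both indices below \<open>m\<close> matter.
\<close>

type_synonym 'n blockmat = "nat \<Rightarrow> nat \<Rightarrow> real^('n idx)^('n idx)"

definition block_inverse :: "nat \<Rightarrow> ('n::finite) blockmat \<Rightarrow> 'n blockmat \<Rightarrow> bool" where
  "block_inverse m B C \<longleftrightarrow>
     (\<forall>k<m. \<forall>l<m. (\<Sum>j<m. B k j ** C j l) = (if k = l then mat 1 else 0)) \<and>
     (\<forall>k<m. \<forall>l<m. (\<Sum>j<m. C k j ** B j l) = (if k = l then mat 1 else 0))"

definition block_invertible :: "nat \<Rightarrow> ('n::finite) blockmat \<Rightarrow> bool" where
  "block_invertible m B \<longleftrightarrow> (\<exists>C. block_inverse m B C)"

text \<open>\<open>\<Lambda>\<^sub>k\<close>, the partial derivative of \<open>f\<^sub>k\<close> with respect to \<open>Q\<^sub>k\<close> at the centre, for \<open>k \<ge> 1\<close>.\<close>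

definition Lam :: "real \<Rightarrow> (int \<Rightarrow> complex^'n^'n) \<Rightarrow> 'n seqX \<Rightarrow> nat \<Rightarrow> real^('n::finite idx)^('n idx)" where
  "Lam \<tau> a xbar k =
     matrix (\<lambda>v. vec_of (frechet_derivative (\<lambda>q. fmap \<tau> a (xbar(k := q)) k) (at (xbar k)) (mat2_of v)))"

definition Aop :: "real \<Rightarrow> (int \<Rightarrow> complex^'n^'n) \<Rightarrow> nat \<Rightarrow> 'n blockmat \<Rightarrow> 'n seqX
    \<Rightarrow> 'n seqX \<Rightarrow> ('n::finite) seqX" where
  "Aop \<tau> a m Am xbar x k =
     (if k < m then mat2_of (\<Sum>l<m. Am k l *v vec_of (x l))
      else mat2_of (matrix_inv (Lam \<tau> a xbar k) *v vec_of (x k)))"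

definition Tmap :: "real \<Rightarrow> (int \<Rightarrow> complex^'n^'n) \<Rightarrow> nat \<Rightarrow> 'n blockmat \<Rightarrow> 'n seqX
    \<Rightarrow> 'n seqX \<Rightarrow> ('n::finite) seqX" where
  "Tmap \<tau> a m Am xbar x = (\<lambda>k. x k - Aop \<tau> a m Am xbar (fmap \<tau> a x) k)"


section \<open>Radii polynomials\<close>

definition radii_poly :: "real \<Rightarrow> ('n::finite) seqX \<Rightarrow> (nat \<Rightarrow> real \<Rightarrow> 'n mat2) \<Rightarrow> nat \<Rightarrow> real \<Rightarrow> 'n mat2" where
  "radii_poly s Y Z k r = Y k + Z k r - (r / wt k powr s) *\<^sub>R (ones, ones)"

definition radii_poly_tail :: "real \<Rightarrow> nat \<Rightarrow> real \<Rightarrow> (real \<Rightarrow> real) \<Rightarrow> real \<Rightarrow> real" where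
  "radii_poly_tail s M Yhat Zhat r = Yhat + Zhat r - r / wt M powr s"

end

theory Submission
  imports Defs
begin

text \<open>
  On \<open>\<Omega>\<^sup>s\<close> the map \<open>f\<close> is affine plus the quadratic term \<open>Q\<^sub>k R\<close>; the convolution is bounded because
  \<open>s > 1\<close>, and \<open>f\<close> loses exactly one power of \<open>k\<close>, which \<open>A\<close> gains back. So \<open>T\<close> is Frechet
  differentiable, with a remainder that is exactly quadratic. The mean value theorem, applied to each
  matrix entry along segments, turns the bounds \<open>Z\<^sub>k(r)\<close> into Lipschitz bounds. As \<open>Y\<^sub>k \<ge> 0\<close>, negative
  radii polynomials make \<open>T\<close> a contraction of the ball into itself; the weighted tail bounds make the
  infinitely many conditions \<open>k \<ge> M\<close> equivalent to the single one at \<open>k = M\<close>, so the contraction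
  factor is a maximum over finitely many entries. Finally \<open>A\<close> is injective, so fixed points of \<open>T\<close>
  are zeros of \<open>f\<close>.
\<close>

section \<open>Entries and weighted norms\<close>

lemma vec_of_add: "vec_of (P + Q) = vec_of P + vec_of Q"
  by (auto simp: vec_of_def vec_eq_iff split: sum.split)

lemma vec_of_diff: "vec_of (P - Q) = vec_of P - vec_of Q"
  by (auto simp: vec_of_def vec_eq_iff split: sum.split)

lemma vec_of_scaleR: "vec_of (c *\<^sub>R P) = c *\<^sub>R vec_of P"
  by (auto simp: vec_of_def vec_eq_iff split: sum.split)

lemma vec_of_mat2_of [simp]: "vec_of (mat2_of v) = v"
  by (auto simp: vec_of_def mat2_of_def vec_eq_iff split: sum.split)

lemma mat2_of_vec_of [simp]: "mat2_of (vec_of P) = P"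
  by (auto simp: vec_of_def mat2_of_def vec_eq_iff prod_eq_iff)

lemma vec_of_inject [simp]: "vec_of P = vec_of Q \<longleftrightarrow> P = Q"
  by (metis mat2_of_vec_of)

lemma vec_of_zero [simp]: "vec_of 0 = 0"
  by (auto simp: vec_of_def vec_eq_iff split: sum.split)

lemma vec_of_ones: "vec_of (ones, ones) $ c = 1"
  by (auto simp: vec_of_def ones_def split: sum.split)

text \<open>All entrywise conditions are moved to the single index \<open>c\<close>, so that later
  estimates are about one real number at a time.\<close>

lemma cw_le_iff_vec_of: "cw_le P Q \<longleftrightarrow> (\<forall>c. vec_of P $ c \<le> vec_of Q $ c)"
proof
  assume "cw_le P Q"
  then show "\<forall>c. vec_of P $ c \<le> vec_of Q $ c"
    by (auto simp: cw_le_def vec_of_def split: sum.split)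
next
  assume R: "\<forall>c. vec_of P $ c \<le> vec_of Q $ c"
  show "cw_le P Q"
    unfolding cw_le_def
  proof (intro allI)
    fix i j
    show "fst P $ i $ j \<le> fst Q $ i $ j \<and> snd P $ i $ j \<le> snd Q $ i $ j"
      using R[rule_format, of "Inl (i, j)"] R[rule_format, of "Inr (i, j)"] by (simp add: vec_of_def)
  qed
qed

lemma cw_less_imp_vec_of: "cw_less P Q \<Longrightarrow> vec_of P $ c < vec_of Q $ c"
  by (auto simp: cw_less_def vec_of_def split: sum.split)

lemma vec_of_cw_abs: "vec_of (cw_abs P) $ c = \<bar>vec_of P $ c\<bar>"
  by (auto simp: cw_abs_def vec_of_def split: sum.split)

text \<open>Extracts from the bound on the supremum a real bound for each derivative value. In the
  extended reals every member lies below the supremum, bounded or not.\<close>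

lemma cw_Sup_le_imp_vec_of:
  assumes "cw_le (cw_Sup S) (ereal_mat2 Q)" "P \<in> S"
  shows "vec_of P $ c \<le> vec_of Q $ c"
proof -
  have "ereal (fst P $ i $ j) \<le> (SUP P\<in>S. ereal (fst P $ i $ j))"
       "ereal (snd P $ i $ j) \<le> (SUP P\<in>S. ereal (snd P $ i $ j))" for i j
    using assms(2) by (auto intro: SUP_upper)
  then have "ereal (fst P $ i $ j) \<le> ereal (fst Q $ i $ j)"
       "ereal (snd P $ i $ j) \<le> ereal (snd Q $ i $ j)" for i j
    using assms(1) order_trans unfolding cw_le_def cw_Sup_def ereal_mat2_def by fastforce+
  then show ?thesis by (auto simp: vec_of_def split: sum.split)
qed

section \<open>Maximum norms of matrices\<close>

lemma mat_max_le_iff: "mat_max B \<le> c \<longleftrightarrow> (\<forall>i j. norm (B $ i $ j) \<le> c)"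
  unfolding mat_max_def by (subst Max_le_iff) auto

lemma mat2_max_le_iff: "mat2_max P \<le> b \<longleftrightarrow> (\<forall>c. \<bar>vec_of P $ c\<bar> \<le> b)"
proof
  assume "mat2_max P \<le> b"
  then show "\<forall>c. \<bar>vec_of P $ c\<bar> \<le> b"
    by (auto simp: mat2_max_def mat_max_le_iff vec_of_def split: sum.split)
next
  assume R: "\<forall>c. \<bar>vec_of P $ c\<bar> \<le> b"
  have "\<bar>fst P $ i $ j\<bar> \<le> b" "\<bar>snd P $ i $ j\<bar> \<le> b" for i j
      using R[rule_format, of "Inl (i, j)"] R[rule_format, of "Inr (i, j)"] by (simp_all add: vec_of_def)
  then show "mat2_max P \<le> b"
    by (auto simp: mat2_max_def mat_max_le_iff)
qed

lemma abs_vec_of_le: "\<bar>vec_of P $ c\<bar> \<le> mat2_max P"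
  using mat2_max_le_iff by blast

lemma norm_le_mat_max: "norm (B $ i $ j) \<le> mat_max B"
  using mat_max_le_iff by blast

lemma mat_max_nonneg [simp]: "0 \<le> mat_max B"
  by (rule order_trans[OF norm_ge_zero norm_le_mat_max])

lemma mat_max_fst_le: "mat_max (fst P) \<le> mat2_max P"
  and mat_max_snd_le: "mat_max (snd P) \<le> mat2_max P"
  by (auto simp: mat2_max_def)

lemma mat2_max_nonneg [simp]: "0 \<le> mat2_max P"
  by (rule order_trans[OF abs_ge_zero abs_vec_of_le])

lemma mat2_max_add: "mat2_max (P + Q) \<le> mat2_max P + mat2_max Q"
  unfolding mat2_max_le_iff vec_of_add
  by (auto intro!: order_trans[OF abs_triangle_ineq] add_mono abs_vec_of_le)

lemma mat2_max_scaleR: "mat2_max (c *\<^sub>R P) \<le> \<bar>c\<bar> * mat2_max P"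
  unfolding mat2_max_le_iff vec_of_scaleR
  by (auto simp: abs_mult abs_vec_of_le intro: mult_left_mono)

lemma mat2_max_zero [simp]: "mat2_max 0 = 0"
  by (rule antisym) (simp_all add: mat2_max_le_iff)

section \<open>Weights, the spaces Omega and their balls\<close>

lemma wt_ge_1 [simp]: "1 \<le> wt k"
  by (auto simp: wt_def)

lemma wt_pos [simp]: "0 < wt k"
  by (auto simp: wt_def)

lemma wt_nonzero [simp]: "wt k \<noteq> 0"
  by (auto simp: wt_def)

lemma wt_powr_pos [simp]: "0 < wt k powr s"
  by (auto simp: wt_def)

text \<open>Estimates are phrased with a real bound on the norm rather than with its value; this
  lemma trades the extended reals for real inequalities at each index.\<close>

lemma seq_norm_le_iff: "seq_norm s x \<le> ereal c \<longleftrightarrow> (\<forall>k. mat2_max (x k) * wt k powr s \<le> c)"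
  by (simp add: seq_norm_def SUP_le_iff)

lemma seq_norm_nonneg: "0 \<le> seq_norm s x"
  unfolding seq_norm_def by (rule SUP_upper2[of 0]) auto

lemma Omega_iff: "x \<in> Omega s \<longleftrightarrow> (\<exists>c. seq_norm s x \<le> ereal c)"
proof
  assume "x \<in> Omega s"
  then show "\<exists>c. seq_norm s x \<le> ereal c"
    using seq_norm_nonneg[of s x] by (cases "seq_norm s x") (auto simp: Omega_def)
qed (auto simp: Omega_def less_top[symmetric])

lemma Omega_seq_norm_real:
  assumes "x \<in> Omega s"
  obtains c where "0 \<le> c" "seq_norm s x = ereal c"
  using assms seq_norm_nonneg[of s x] by (cases "seq_norm s x") (auto simp: Omega_def)

lemma OmegaI: "(\<And>k. mat2_max (x k) * wt k powr s \<le> c) \<Longrightarrow> x \<in> Omega s"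
  unfolding Omega_iff seq_norm_le_iff by blast

lemma seq_norm_add: "seq_norm s (\<lambda>k. x k + y k) \<le> seq_norm s x + seq_norm s y"
  unfolding seq_norm_def[of s "\<lambda>k. x k + y k"]
proof (rule SUP_least)
  fix k
  have "mat2_max (x k + y k) * wt k powr s \<le> mat2_max (x k) * wt k powr s + mat2_max (y k) * wt k powr s"
    using mat2_max_add[of "x k" "y k"] mult_right_mono[of _ _ "wt k powr s"]
    by (metis distrib_right less_eq_real_def wt_powr_pos)
  then have "ereal (mat2_max (x k + y k) * wt k powr s)
     \<le> ereal (mat2_max (x k) * wt k powr s) + ereal (mat2_max (y k) * wt k powr s)" by simp
  also have "\<dots> \<le> seq_norm s x + seq_norm s y"
    unfolding seq_norm_def by (intro add_mono SUP_upper) auto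
  finally show "ereal (mat2_max (x k + y k) * wt k powr s) \<le> seq_norm s x + seq_norm s y" .
qed

lemma seq_norm_scaleR_le:
  assumes "seq_norm s x \<le> ereal b"
  shows "seq_norm s (\<lambda>k. c *\<^sub>R x k) \<le> ereal (\<bar>c\<bar> * b)"
  unfolding seq_norm_le_iff
proof
  fix k
  have "mat2_max (c *\<^sub>R x k) * wt k powr s \<le> \<bar>c\<bar> * mat2_max (x k) * wt k powr s"
    by (intro mult_right_mono mat2_max_scaleR) auto
  also have "\<dots> \<le> \<bar>c\<bar> * b"
    using assms by (auto simp: seq_norm_le_iff mult.assoc intro: mult_left_mono)
  finally show "mat2_max (c *\<^sub>R x k) * wt k powr s \<le> \<bar>c\<bar> * b" .
qed

lemma Omega_add: "x \<in> Omega s \<Longrightarrow> y \<in> Omega s \<Longrightarrow> (\<lambda>k. x k + y k) \<in> Omega s"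
  using seq_norm_add[of s x y] by (auto simp: Omega_def)

lemma Omega_scaleR: "x \<in> Omega s \<Longrightarrow> (\<lambda>k. c *\<^sub>R x k) \<in> Omega s"
  using seq_norm_scaleR_le unfolding Omega_iff by blast

lemma ball_at_iff:
  "x \<in> ball_at s c r \<longleftrightarrow> seq_norm s (\<lambda>k. x k - c k) \<le> ereal r"
proof
  assume "seq_norm s (\<lambda>k. x k - c k) \<le> ereal r"
  then have "(\<lambda>k. x k - c k) \<in> ball0 s r" unfolding ball0_def using Omega_iff by blast
  then show "x \<in> ball_at s c r" unfolding ball_at_def
    by (rule_tac CollectI, rule_tac exI[of _ "\<lambda>k. x k - c k"]) auto
qed (auto simp: ball_at_def ball0_def)

lemma ball0_iff: "b \<in> ball0 s r \<longleftrightarrow> seq_norm s b \<le> ereal r"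
  unfolding ball0_def using Omega_iff by blast

lemma seq_norm_diff_le_iff:
  "seq_norm s (\<lambda>k. x k - y k) \<le> ereal e \<longleftrightarrow>
    (\<forall>k c. \<bar>vec_of (x k) $ c - vec_of (y k) $ c\<bar> \<le> e / wt k powr s)"
  unfolding seq_norm_le_iff pos_le_divide_eq[OF wt_powr_pos, symmetric] mat2_max_le_iff vec_of_diff
  by simp

section \<open>Differentiable contractions of balls in \<open>\<Omega>\<^sup>s\<close>\<close>

text \<open>A single coordinate is controlled by the weighted norm up to the fixed factor
  \<open>wt k powr - s\<close>, so an o-remainder in the norm is an o-remainder in that coordinate.
  This makes the one-variable mean value theorem available.\<close>

lemma Omega_derivative_along_line:
  assumes D: "has_Omega_derivative s F D (\<lambda>k. x k + t *\<^sub>R h k)"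
    and h: "h \<in> Omega s"
  shows "((\<lambda>t. vec_of (F (\<lambda>k. x k + t *\<^sub>R h k) k) $ c) has_field_derivative vec_of (D h k) $ c) (at t)"
proof -
  obtain b where b: "b \<ge> 0" "seq_norm s h = ereal b" using Omega_seq_norm_real[OF h] by blast
  let ?x = "\<lambda>t. \<lambda>k. x k + t *\<^sub>R h k"
  let ?g = "\<lambda>t. vec_of (F (?x t) k) $ c"
  have "\<exists>d>0. \<forall>u. u \<noteq> 0 \<and> norm (u - 0) < d \<longrightarrow> norm ((?g (t + u) - ?g t) / u - vec_of (D h k) $ c) < e"
    if e: "e > 0" for e
  proof -
    \<comment> \<open>Chosen so that the weight at \<open>k\<close> cancels and the factor
      \<open>b / (b + 1)\<close>, below 1, remains; \<open>b + 1\<close> is positive even when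
      \<open>h\<close> is zero.\<close>
    define e' where "e' = e * wt k powr s / (b + 1)"
    have e': "e' > 0" unfolding e'_def using e b by (intro divide_pos_pos mult_pos_pos) auto
    have Dsc: "D (\<lambda>k. u *\<^sub>R h k) = (\<lambda>k. u *\<^sub>R D h k)" for u
      using D h by (auto simp: has_Omega_derivative_def)
    obtain \<delta> where \<delta>: "\<delta> > 0" and small: "\<And>g. g \<in> Omega s \<Longrightarrow> seq_norm s g < ereal \<delta> \<Longrightarrow>
        seq_norm s (\<lambda>k. F (\<lambda>l. ?x t l + g l) k - F (?x t) k - D g k) \<le> ereal e' * seq_norm s g"
      using D e' unfolding has_Omega_derivative_def by blast
    show ?thesis
    proof (intro exI conjI allI impI)
      show "\<delta> / (b + 1) > 0" using \<delta> b by simp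
      fix u :: real assume u: "u \<noteq> 0 \<and> norm (u - 0) < \<delta> / (b + 1)"
      have le: "seq_norm s (\<lambda>k. u *\<^sub>R h k) \<le> ereal (\<bar>u\<bar> * b)"
        using seq_norm_scaleR_le[of s h b u] b by simp
      have "\<bar>u\<bar> * b \<le> \<bar>u\<bar> * (b + 1)" by (simp add: mult_left_mono)
      also have "\<dots> < \<delta>" using u b by (simp add: pos_less_divide_eq)
      finally have "seq_norm s (\<lambda>k. u *\<^sub>R h k) < ereal \<delta>"
        using le by (simp add: order_le_less_trans)
      from small[OF Omega_scaleR[OF h] this]
      have "seq_norm s (\<lambda>k. F (?x (t + u)) k - F (?x t) k - u *\<^sub>R D h k) \<le> ereal e' * seq_norm s (\<lambda>k. u *\<^sub>R h k)"
        by (simp add: Dsc algebra_simps)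
      also have "\<dots> \<le> ereal e' * ereal (\<bar>u\<bar> * b)"
        using le e' by (intro ereal_mult_left_mono) auto
      finally have "mat2_max (F (?x (t + u)) k - F (?x t) k - u *\<^sub>R D h k) * wt k powr s \<le> e' * (\<bar>u\<bar> * b)"
        by (simp add: seq_norm_le_iff)
      then have "mat2_max (F (?x (t + u)) k - F (?x t) k - u *\<^sub>R D h k) \<le> e' * (\<bar>u\<bar> * b) / wt k powr s"
        by (simp add: pos_le_divide_eq)
      also have "\<dots> = e * \<bar>u\<bar> * (b / (b + 1))" by (simp add: e'_def wt_powr_pos[THEN less_imp_neq, symmetric])
      finally have "\<bar>vec_of (F (?x (t + u)) k - F (?x t) k - u *\<^sub>R D h k) $ c\<bar> \<le> e * \<bar>u\<bar> * (b / (b + 1))"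
        using abs_vec_of_le order_trans by blast
      also have "\<dots> < e * \<bar>u\<bar> * 1" using e u b by (intro mult_strict_left_mono) auto
      finally have *: "\<bar>?g (t + u) - ?g t - u * vec_of (D h k) $ c\<bar> < e * \<bar>u\<bar>"
        by (simp add: vec_of_diff vec_of_scaleR)
      have "(?g (t + u) - ?g t) / u - vec_of (D h k) $ c = (?g (t + u) - ?g t - u * vec_of (D h k) $ c) / u"
        using u by (simp add: field_simps)
      with * u show "norm ((?g (t + u) - ?g t) / u - vec_of (D h k) $ c) < e"
        by (simp add: abs_divide pos_divide_less_eq)
    qed
  qed
  then show ?thesis unfolding DERIV_def LIM_eq by simp
qed


text \<open>Contraction principle in coordinates. \<open>self\<close> makes the ball invariant,
  \<open>contr\<close> gives a factor uniform in all entries, and \<open>D\<close> may be any choice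
  of derivatives on the ball.\<close>

lemma radii_fixed_point:
  fixes F :: "('n::finite) seqX \<Rightarrow> 'n seqX"
  assumes c0: "c0 \<in> Omega s" and s: "0 \<le> s" and r: "r > 0" and \<kappa>: "0 < \<kappa>" "\<kappa> < 1"
    and deriv: "\<And>b. b \<in> ball0 s r \<Longrightarrow> has_Omega_derivative s F (D (\<lambda>k. c0 k + b k)) (\<lambda>k. c0 k + b k)"
    and \<eta>: "\<And>k c. \<bar>vec_of (F c0 k - c0 k) $ c\<bar> \<le> \<eta> k c"
    and \<zeta>: "\<And>k c b1 b2. b1 \<in> ball0 s r \<Longrightarrow> b2 \<in> ball0 s r \<Longrightarrow>
              \<bar>vec_of (D (\<lambda>k. c0 k + b1 k) b2 k) $ c\<bar> \<le> \<zeta> k c"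
    and self: "\<And>k c. \<eta> k c + \<zeta> k c \<le> r / wt k powr s"
    and contr: "\<And>k c. \<zeta> k c \<le> \<kappa> * (r / wt k powr s)"
  shows "\<exists>!x. x \<in> ball_at s c0 r \<and> F x = x"
proof -
  \<comment> \<open>\<open>\<zeta>\<close> bounds the derivative only on directions of norm at most
    \<open>r\<close>. The increment is therefore rescaled by \<open>r / e\<close>, which is why
    \<open>e\<close> is a positive upper bound of the distance and not the distance itself.\<close>
  have lip: "\<bar>vec_of (F y k) $ c - vec_of (F x k) $ c\<bar> \<le> e / r * \<zeta> k c"
    if x: "x \<in> ball_at s c0 r" and y: "y \<in> ball_at s c0 r" and e: "e > 0"
      and xy: "seq_norm s (\<lambda>k. y k - x k) \<le> ereal e" for x y k c e
  proof -
    define h where "h = (\<lambda>k. y k - x k)"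
    define b where "b = (\<lambda>k. (r / e) *\<^sub>R h k)"
    have h\<Omega>: "h \<in> Omega s" using xy unfolding Omega_iff h_def by blast
    have b: "b \<in> ball0 s r"
      using seq_norm_scaleR_le[OF xy, of "r / e"] e r unfolding ball0_iff b_def h_def by simp
    \<comment> \<open>Convexity of the ball: the point of the segment is a convex combination of
      \<open>x\<close> and \<open>y\<close>.\<close>
    have seg: "(\<lambda>k. x k + t *\<^sub>R h k - c0 k) \<in> ball0 s r" if t: "0 \<le> t" "t \<le> 1" for t
    proof -
      have "seq_norm s (\<lambda>k. (1 - t) *\<^sub>R (x k - c0 k) + t *\<^sub>R (y k - c0 k))
          \<le> ereal (\<bar>1 - t\<bar> * r) + ereal (\<bar>t\<bar> * r)"
        using x y by (intro order_trans[OF seq_norm_add] add_mono seq_norm_scaleR_le) (simp_all add: ball_at_iff)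
      moreover have "(\<lambda>k. (1 - t) *\<^sub>R (x k - c0 k) + t *\<^sub>R (y k - c0 k)) = (\<lambda>k. x k + t *\<^sub>R h k - c0 k)"
        by (simp add: h_def algebra_simps)
      ultimately show ?thesis using t by (simp add: ball0_iff algebra_simps)
    qed
    let ?x = "\<lambda>t. \<lambda>k. x k + t *\<^sub>R h k"
    have dx: "has_Omega_derivative s F (D (?x t)) (?x t)"
      and bx: "\<bar>vec_of (D (?x t) b k) $ c\<bar> \<le> \<zeta> k c" if t: "0 \<le> t" "t \<le> 1" for t
      using deriv[OF seg[OF t]] \<zeta>[OF seg[OF t] b] by simp_all
    have hb: "h = (\<lambda>k. (e / r) *\<^sub>R b k)" using e r by (simp add: b_def)
    have hx: "\<bar>vec_of (D (?x t) h k) $ c\<bar> \<le> e / r * \<zeta> k c" if t: "0 \<le> t" "t \<le> 1" for t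
    proof -
      have "b \<in> Omega s" using b by (simp add: ball0_def)
      then have "D (?x t) (\<lambda>k. (e / r) *\<^sub>R b k) = (\<lambda>k. (e / r) *\<^sub>R D (?x t) b k)"
        using dx[OF t] by (simp add: has_Omega_derivative_def)
      then have "vec_of (D (?x t) h k) $ c = e / r * vec_of (D (?x t) b k) $ c"
        by (simp add: hb[symmetric] vec_of_scaleR)
      then show ?thesis using bx[OF t] e r by (simp add: abs_mult divide_right_mono mult_left_mono)
    qed
    let ?g = "\<lambda>t. vec_of (F (?x t) k) $ c"
    \<comment> \<open>The intermediate point depends on the entry \<open>(k, c)\<close>; this is
      harmless because \<open>hx\<close> holds along the whole segment.\<close>
    have "\<exists>z. 0 < z \<and> z < 1 \<and> ?g 1 - ?g 0 = (1 - 0) * vec_of (D (?x z) h k) $ c"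
      using Omega_derivative_along_line[OF dx h\<Omega>]
      by (intro MVT2[where f = ?g and f' = "\<lambda>z. vec_of (D (?x z) h k) $ c"]) auto
    then obtain z where z: "0 < z" "z < 1" "?g 1 - ?g 0 = vec_of (D (?x z) h k) $ c" by auto
    then have "\<bar>?g 1 - ?g 0\<bar> \<le> e / r * \<zeta> k c" using hx[of z] by simp
    then show ?thesis by (simp add: h_def)
  qed
  have contraction: "seq_norm s (\<lambda>k. F y k - F x k) \<le> ereal (\<kappa> * e)"
    if x: "x \<in> ball_at s c0 r" and y: "y \<in> ball_at s c0 r" and e: "e > 0"
      and xy: "seq_norm s (\<lambda>k. y k - x k) \<le> ereal e" for x y e
    unfolding seq_norm_diff_le_iff
  proof (intro allI)
    fix k c
    have "\<bar>vec_of (F y k) $ c - vec_of (F x k) $ c\<bar> \<le> e / r * \<zeta> k c" by (rule lip[OF x y e xy])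
    also have "\<dots> \<le> e / r * (\<kappa> * (r / wt k powr s))"
      using contr e r by (intro mult_left_mono) auto
    also have "\<dots> = \<kappa> * e / wt k powr s" using r by simp
    finally show "\<bar>vec_of (F y k) $ c - vec_of (F x k) $ c\<bar> \<le> \<kappa> * e / wt k powr s" .
  qed
  have c0_ball: "c0 \<in> ball_at s c0 r" using r by (simp add: ball_at_iff seq_norm_le_iff)
  have maps: "F x \<in> ball_at s c0 r" if x: "x \<in> ball_at s c0 r" for x
    unfolding ball_at_iff seq_norm_diff_le_iff
  proof (intro allI)
    fix k c
    \<comment> \<open>With \<open>e = r\<close> the Lipschitz bound from the centre is exactly
      \<open>\<zeta>\<close>; adding the displacement \<open>\<eta>\<close> of the centre gives the
      left side of \<open>self\<close>.\<close>
    have "\<bar>vec_of (F x k) $ c - vec_of (F c0 k) $ c\<bar> \<le> r / r * \<zeta> k c"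
      by (rule lip[OF c0_ball x r]) (use x in \<open>simp add: ball_at_iff\<close>)
    then show "\<bar>vec_of (F x k) $ c - vec_of (c0 k) $ c\<bar> \<le> r / wt k powr s"
      using \<eta>[of k c] self[of k c] r by (simp add: vec_of_diff)
  qed
  have geometric_zero: "d = 0" if "\<And>n. \<bar>d\<bar> \<le> \<kappa> ^ n * B" for d B :: real
  proof -
    have "(\<lambda>n. \<kappa> ^ n * B) \<longlonglongrightarrow> 0"
      using \<kappa> by (intro tendsto_mult_left_zero LIMSEQ_realpow_zero) auto
    then have "\<bar>d\<bar> \<le> 0" by (rule LIMSEQ_le_const) (use that in auto)
    then show ?thesis by simp
  qed
  have unique: "x = y" if x: "x \<in> ball_at s c0 r" "F x = x" and y: "y \<in> ball_at s c0 r" "F y = y" for x y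
  proof -
    \<comment> \<open>Two points of the ball are at most \<open>2 * r\<close> apart, and applying
      \<open>F\<close> to two fixed points improves any bound by \<open>\<kappa>\<close>.\<close>
    have *: "seq_norm s (\<lambda>k. y k - x k) \<le> ereal (\<kappa> ^ n * (2 * r))" for n
    proof (induction n)
      case 0
      have "seq_norm s (\<lambda>k. (y k - c0 k) + (-1) *\<^sub>R (x k - c0 k)) \<le> ereal r + ereal (\<bar>-1\<bar> * r)"
        using x y by (intro order_trans[OF seq_norm_add] add_mono seq_norm_scaleR_le) (simp_all add: ball_at_iff)
      then show ?case by simp
    next
      case (Suc n)
      show ?case
        using contraction[OF x(1) y(1) _ Suc] x y r \<kappa> by (simp add: mult.assoc)
    qed
    have "vec_of (y k) $ c - vec_of (x k) $ c = 0" for k c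
      by (rule geometric_zero[of _ "2 * r / wt k powr s"]) (use * in \<open>simp add: seq_norm_diff_le_iff\<close>)
    then have "vec_of (x k) = vec_of (y k)" for k by (simp add: vec_eq_iff)
    then show ?thesis by (auto simp: fun_eq_iff)
  qed
  define u where "u n = (F ^^ n) c0" for n
  have u: "u n \<in> ball_at s c0 r" for n
    by (induction n) (simp_all add: u_def c0_ball maps)
  have u_Suc: "F (u n) = u (Suc n)" for n by (simp add: u_def)
  \<comment> \<open>Every iterate stays within \<open>r\<close> of \<open>c0\<close>, so applying
    the contraction \<open>n\<close> times gives a bound uniform in \<open>j\<close> without summing
    a geometric series.\<close>
  have near: "seq_norm s (\<lambda>k. u (n + j) k - u n k) \<le> ereal (\<kappa> ^ n * r)" for n j
  proof (induction n)
    case 0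
    then show ?case using u[of j] by (simp add: ball_at_iff u_def)
  next
    case (Suc n)
    show ?case
      using contraction[OF u u _ Suc] r \<kappa> by (simp add: u_Suc mult.assoc)
  qed
  define v where "v k c n = vec_of (u n k) $ c" for k c n
  have v: "\<bar>v k c (n + j) - v k c n\<bar> \<le> \<kappa> ^ n * (r / wt k powr s)" for k c n j
    using near[of n j] by (simp add: seq_norm_diff_le_iff v_def)
  have conv: "convergent (v k c)" for k c
  proof -
    let ?B = "r / wt k powr s"
    have lim0: "(\<lambda>n. \<kappa> ^ n * ?B) \<longlonglongrightarrow> 0"
      using \<kappa> by (intro tendsto_mult_left_zero LIMSEQ_realpow_zero) auto
    have "Cauchy (v k c)"
    proof (rule CauchyI')
      fix e :: real assume "e > 0"
      then obtain N where N: "\<And>n. n \<ge> N \<Longrightarrow> \<kappa> ^ n * ?B < e"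
        using order_tendstoD(2)[OF lim0] unfolding eventually_sequentially by metis
      have "norm (v k c m - v k c n) < e" if "m \<ge> N" "n > m" for m n
      proof -
        have "\<bar>v k c n - v k c m\<bar> \<le> \<kappa> ^ m * ?B" using v[of k c m "n - m"] that by simp
        then show ?thesis using N[OF that(1)] by (simp add: abs_minus_commute)
      qed
      then show "\<exists>M. \<forall>m\<ge>M. \<forall>n>m. dist (v k c m) (v k c n) < e"
        unfolding dist_norm by blast
    qed
    then show ?thesis by (simp add: Cauchy_convergent_iff)
  qed
  \<comment> \<open>The limit is taken coordinate by coordinate; the bounds of \<open>near\<close>
    survive it and give convergence in norm.\<close>
  define x where "x k = mat2_of (\<chi> c. lim (v k c))" for k
  have lim: "v k c \<longlonglongrightarrow> vec_of (x k) $ c" for k c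
    using conv[of k c] by (simp add: x_def convergent_LIMSEQ_iff)
  have xu: "seq_norm s (\<lambda>k. x k - u n k) \<le> ereal (\<kappa> ^ n * r)" for n
    unfolding seq_norm_diff_le_iff
  proof (intro allI)
    fix k c
    have "(\<lambda>j. \<bar>v k c (j + n) - v k c n\<bar>) \<longlonglongrightarrow> \<bar>vec_of (x k) $ c - v k c n\<bar>"
      by (intro tendsto_intros LIMSEQ_ignore_initial_segment lim)
    then have "\<bar>vec_of (x k) $ c - v k c n\<bar> \<le> \<kappa> ^ n * (r / wt k powr s)"
      by (rule LIMSEQ_le_const2) (use v[of k c n] in \<open>simp add: add.commute\<close>)
    then show "\<bar>vec_of (x k) $ c - vec_of (u n k) $ c\<bar> \<le> \<kappa> ^ n * r / wt k powr s" by (simp add: v_def)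
  qed
  have x_ball: "x \<in> ball_at s c0 r" using xu[of 0] by (simp add: ball_at_iff u_def)
  have "F x = x"
  proof
    fix k
    have "vec_of (F x k) $ c = vec_of (x k) $ c" for c
    proof -
      \<comment> \<open>Both \<open>F x\<close> and \<open>x\<close> are compared with
        \<open>u (Suc n)\<close>, the image of \<open>u n\<close>; each distance is at most
        \<open>\<kappa> ^ n * r\<close> in norm.\<close>
      have "\<bar>vec_of (F x k) $ c - vec_of (x k) $ c\<bar> \<le> \<kappa> ^ n * (2 * r / wt k powr s)" for n
      proof -
        have 1: "\<bar>vec_of (F x k) $ c - vec_of (F (u n) k) $ c\<bar> \<le> \<kappa> * (\<kappa> ^ n * r) / wt k powr s"
          using contraction[OF u x_ball _ xu, of n] r \<kappa> by (simp add: seq_norm_diff_le_iff)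
        also have "\<dots> \<le> \<kappa> ^ n * r / wt k powr s"
          using \<kappa> r by (intro divide_right_mono) (auto simp: mult_left_le_one_le)
        finally have 1: "\<bar>vec_of (F x k) $ c - v k c (Suc n)\<bar> \<le> \<kappa> ^ n * r / wt k powr s"
          by (simp add: u_Suc v_def)
        have "\<bar>vec_of (x k) $ c - v k c (Suc n)\<bar> \<le> \<kappa> ^ Suc n * r / wt k powr s"
          using xu[of "Suc n"] by (simp add: seq_norm_diff_le_iff v_def)
        also have "\<dots> \<le> \<kappa> ^ n * r / wt k powr s"
          using \<kappa> r by (intro divide_right_mono) (auto simp: mult_left_le_one_le mult.assoc)
        finally have "\<bar>vec_of (x k) $ c - v k c (Suc n)\<bar> \<le> \<kappa> ^ n * r / wt k powr s" .
        moreover have "\<kappa> ^ n * (2 * r / wt k powr s) = \<kappa> ^ n * r / wt k powr s + \<kappa> ^ n * r / wt k powr s"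
          by simp
        ultimately show ?thesis using 1 by linarith
      qed
      from geometric_zero[OF this] show ?thesis by simp
    qed
    then have "vec_of (F x k) = vec_of (x k)" by (simp add: vec_eq_iff)
    then show "F x k = x k" by simp
  qed
  with x_ball unique show ?thesis by blast
qed

section \<open>Decay form of the norm and estimates for matrix operations\<close>

lemma seq_norm_le_iff':
  "seq_norm s x \<le> ereal b \<longleftrightarrow> (\<forall>k. mat2_max (x k) \<le> b * wt k powr - s)"
  unfolding seq_norm_le_iff by (simp add: powr_minus divide_inverse[symmetric] pos_le_divide_eq)

lemma seq_norm_imp_nonneg: "seq_norm s x \<le> ereal b \<Longrightarrow> 0 \<le> b"
  using order_trans[OF seq_norm_nonneg, of s x "ereal b"] by simp

lemma mat_max_add: "mat_max (A + B) \<le> mat_max A + mat_max B"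
  unfolding mat_max_le_iff
  by (auto intro!: order_trans[OF norm_triangle_ineq] add_mono norm_le_mat_max)

lemma mat_max_uminus [simp]: "mat_max (- A) = mat_max A"
  by (simp add: mat_max_def)

lemma mat_max_diff: "mat_max (A - B) \<le> mat_max A + mat_max B"
  using mat_max_add[of A "- B"] by simp

lemma mat_max_scaleR: "mat_max (c *\<^sub>R A) \<le> \<bar>c\<bar> * mat_max A"
  unfolding mat_max_le_iff by (auto simp: norm_le_mat_max intro: mult_left_mono)

lemma mat_max_zero [simp]: "mat_max 0 = 0"
  by (rule antisym) (simp_all add: mat_max_le_iff)

lemma mat_max_Re: "mat_max (map_matrix Re A) \<le> mat_max A"
  unfolding mat_max_le_iff by (auto intro: order_trans[OF abs_Re_le_cmod norm_le_mat_max])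

lemma mat_max_Im: "mat_max (map_matrix Im A) \<le> mat_max A"
  unfolding mat_max_le_iff by (auto intro: order_trans[OF abs_Im_le_cmod norm_le_mat_max])

lemma mat_max_mult:
  fixes A B :: "('a::real_normed_field)^'n^'n"
  shows "mat_max (A ** B) \<le> real CARD('n) * mat_max A * mat_max B"
  unfolding mat_max_le_iff
proof (intro allI)
  fix i j
  have "norm ((A ** B) $ i $ j) \<le> (\<Sum>k\<in>UNIV. norm (A $ i $ k * B $ k $ j))"
    unfolding matrix_matrix_mult_def by (simp add: norm_sum)
  also have "\<dots> \<le> (\<Sum>k\<in>(UNIV::'n set). mat_max A * mat_max B)"
    by (intro sum_mono) (auto simp: norm_mult intro!: mult_mono norm_le_mat_max)
  finally show "norm ((A ** B) $ i $ j) \<le> real CARD('n) * mat_max A * mat_max B" by simp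
qed

lemma mat_max_le_norm: "mat_max A \<le> norm A"
  unfolding mat_max_le_iff by (blast intro: order_trans[OF Finite_Cartesian_Product.norm_nth_le Finite_Cartesian_Product.norm_nth_le])

lemma norm_le_mat_max_card:
  fixes A :: "('a::real_normed_vector)^'n^'n"
  shows "norm A \<le> (real CARD('n))\<^sup>2 * mat_max A"
proof -
  have "norm A \<le> (\<Sum>i\<in>UNIV. norm (A $ i))"
    by (simp add: norm_vec_def L2_set_le_sum)
  also have "\<dots> \<le> (\<Sum>i\<in>UNIV. \<Sum>j\<in>UNIV. norm (A $ i $ j))"
    by (intro sum_mono) (simp add: norm_vec_def L2_set_le_sum)
  also have "\<dots> \<le> (\<Sum>i\<in>(UNIV::'n set). \<Sum>j\<in>(UNIV::'n set). mat_max A)"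
    by (intro sum_mono norm_le_mat_max)
  finally show ?thesis by (simp add: power2_eq_square)
qed

section \<open>Convolutions of weighted sequences\<close>

definition iwt :: "int \<Rightarrow> real" where
  "iwt k = wt (nat \<bar>k\<bar>)"

lemma iwt_of_nat [simp]: "iwt (int k) = wt k"
  by (simp add: iwt_def)

lemma iwt_pos [simp]: "0 < iwt k"
  by (simp add: iwt_def)

lemma iwt_nonzero [simp]: "iwt k \<noteq> 0"
  by (simp add: iwt_def)

lemma iwt_powr_pos [simp]: "0 < iwt k powr s"
  by (simp add: iwt_def)

lemma summable_wt:
  assumes "s > 1" shows "(\<lambda>k. wt k powr - s) summable_on UNIV"
proof -
  have "summable (\<lambda>k. real k powr - s)" using assms by (simp add: summable_real_powr_iff)
  \<comment> \<open>The two sequences differ at index 0 only, where \<open>wt\<close> is 1.\<close>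
  moreover have "eventually (\<lambda>k. real k powr - s = wt k powr - s) sequentially"
    using eventually_gt_at_top[of 0] by eventually_elim (simp add: wt_def)
  ultimately have "summable (\<lambda>k. wt k powr - s)" by (rule summable_cong[THEN iffD1, rotated])
  then show ?thesis by (simp add: summable_on_UNIV_nonneg_real_iff)
qed

lemma summable_iwt:
  assumes "s > 1" shows "(\<lambda>k. iwt k powr - s) summable_on UNIV"
proof -
  \<comment> \<open>The negative part starts at 1, so that 0 is not counted twice.\<close>
  have "UNIV = int ` UNIV \<union> (\<lambda>n. - int n) ` {1..}"
  proof -
    have "k \<in> int ` UNIV \<union> (\<lambda>n. - int n) ` {1..}" for k
    proof (cases "k \<ge> 0")
      case True
      then show ?thesis by (intro UnI1 image_eqI[of _ _ "nat k"]) auto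
    next
      case False
      then show ?thesis by (intro UnI2 image_eqI[of _ _ "nat (- k)"]) auto
    qed
    then show ?thesis by blast
  qed
  moreover have "(\<lambda>k. iwt k powr - s) summable_on int ` UNIV"
    using summable_wt[OF assms] by (subst summable_on_reindex) (auto simp: o_def)
  moreover have "(\<lambda>k. iwt k powr - s) summable_on (\<lambda>n. - int n) ` {1..}"
    using summable_on_subset_banach[OF summable_wt[OF assms], of "{1..}"]
    by (subst summable_on_reindex) (auto simp: o_def inj_on_def iwt_def)
  moreover have "int ` UNIV \<inter> (\<lambda>n. - int n) ` {1..} = {}" by auto
  ultimately show ?thesis
    using summable_on_Un_disjoint[of "\<lambda>k. iwt k powr - s" "int ` UNIV" "(\<lambda>n. - int n) ` {1..}"] by simp
qed

text \<open>The larger of the weights at \<open>l\<close> and \<open>k - l\<close> is at least half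
  the weight at \<open>k\<close>. A product of two decaying factors thus yields full decay in
  \<open>k\<close> times a sum that is summable in \<open>l\<close> for \<open>s > 1\<close>; this
  is what keeps the rate under convolution.\<close>

lemma iwt_triangle:
  assumes "s \<ge> 0"
  shows "iwt l powr - s * iwt (k - l) powr - s
    \<le> 2 powr s * iwt k powr - s * (iwt l powr - s + iwt (k - l) powr - s)"
proof -
  let ?u = "iwt l" and ?v = "iwt (k - l)" and ?w = "iwt k"
  have eq: "iwt j = of_int (max 1 \<bar>j\<bar>)" for j
    by (auto simp: iwt_def wt_def)
  have "max 1 \<bar>k\<bar> \<le> max 1 \<bar>l\<bar> + max 1 \<bar>k - l\<bar>" by arith
  then have "?w \<le> ?u + ?v" unfolding eq by linarith
  then have le: "?w \<le> 2 * max ?u ?v" by linarith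
  have "?w powr s \<le> (2 * max ?u ?v) powr s"
    by (rule powr_mono2[OF assms less_imp_le[OF iwt_pos] le])
  also have "\<dots> = 2 powr s * max ?u ?v powr s"
    by (rule powr_mult)
  also have "max ?u ?v powr s \<le> ?u powr s + ?v powr s"
    by (auto simp: max_def)
  finally have *: "?w powr s \<le> 2 powr s * (?u powr s + ?v powr s)" by simp
  \<comment> \<open>Dividing by the product of all three powers turns the triangle inequality into
    the claim about inverses.\<close>
  have "(?w powr s) / (?w powr s * ?u powr s * ?v powr s) \<le> 2 powr s * (?u powr s + ?v powr s) / (?w powr s * ?u powr s * ?v powr s)"
    by (rule divide_right_mono[OF *]) auto
  moreover have "w / (w * u * v) = inverse u * inverse v"
    "p * (u + v) / (w * u * v) = p * inverse w * (inverse u + inverse v)"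
    if "u \<noteq> 0" "v \<noteq> 0" "w \<noteq> 0" for p u v w :: real
    using that by (simp_all add: field_simps)
  ultimately show ?thesis by (simp add: powr_minus)
qed

text \<open>Two-sided decay with a real constant, whereas \<open>coeff_norm\<close> looks at
  nonnegative indices only.\<close>

definition coeff_bound :: "real \<Rightarrow> real \<Rightarrow> (int \<Rightarrow> complex^'n^'n) \<Rightarrow> bool" where
  "coeff_bound s \<alpha> a \<longleftrightarrow> 0 \<le> \<alpha> \<and> (\<forall>k. mat_max (a k) \<le> \<alpha> * iwt k powr - s)"

text \<open>Weights are at least 1, so decay with exponent \<open>s'\<close> implies decay with the
  smaller \<open>s\<close>; conjugation preserves moduli and carries the bound to negative
  indices.\<close>

lemma coeff_bound_exists:
  assumes fin: "coeff_norm s' a < \<infinity>" and s: "s \<le> s'"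
    and sym: "\<And>k. a (- k) = map_matrix cnj (a k)"
  shows "\<exists>\<alpha>. coeff_bound s \<alpha> a"
proof -
  have "0 \<le> coeff_norm s' a"
    unfolding coeff_norm_def by (rule SUP_upper2[of 0]) auto
  then obtain \<alpha> where \<alpha>: "coeff_norm s' a = ereal \<alpha>" "\<alpha> \<ge> 0"
    using fin by (cases "coeff_norm s' a") auto
  have b: "mat_max (a (int k)) \<le> \<alpha> * wt k powr - s" for k
  proof -
    have "mat_max (a (int k)) * wt k powr s' \<le> \<alpha>"
      using \<alpha>(1) SUP_upper[of k UNIV "\<lambda>k. ereal (mat_max (a (int k)) * wt k powr s')"]
      by (simp add: coeff_norm_def)
    moreover have "mat_max (a (int k)) * wt k powr s \<le> mat_max (a (int k)) * wt k powr s'"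
      using s by (intro mult_left_mono powr_mono) auto
    ultimately show ?thesis by (simp add: powr_minus divide_inverse[symmetric] pos_le_divide_eq)
  qed
  have "mat_max (a k) \<le> \<alpha> * iwt k powr - s" for k
  proof (cases "k \<ge> 0")
    case True
    then show ?thesis using b[of "nat k"] by (simp add: iwt_def)
  next
    case False
    have "mat_max (a k) \<le> mat_max (a (- k))"
      using sym[of "- k"] by (auto simp: mat_max_le_iff norm_le_mat_max)
    then show ?thesis using b[of "nat (- k)"] False by (simp add: iwt_def)
  qed
  then show ?thesis using \<alpha> unfolding coeff_bound_def by blast
qed

section \<open>Convolution with the Fourier coefficients\<close>

lemma mat_max_QC:
  assumes "seq_norm s x \<le> ereal b"
  shows "mat_max (QC x k) \<le> 2 * b * iwt k powr - s"
proof -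
  let ?B = "b * iwt k powr - s"
  have *: "mat2_max (x (nat \<bar>k\<bar>)) \<le> ?B" using assms by (simp add: seq_norm_le_iff' iwt_def)
  have Q1: "mat_max (Q1 x k) \<le> ?B"
    using order_trans[OF mat_max_fst_le *] order_trans[OF mat_max_snd_le *] by (auto simp: Q1_def)
  have Q2: "mat_max (Q2 x k) \<le> ?B"
    using order_trans[OF mat_max_snd_le *] order_trans[OF mat2_max_nonneg *] by (auto simp: Q2_def)
  show ?thesis
    unfolding mat_max_le_iff
  proof (intro allI)
    fix i j
    have "norm (QC x k $ i $ j) \<le> norm (Q1 x k $ i $ j) + norm (Q2 x k $ i $ j)"
      unfolding QC_def by (simp add: norm_triangle_le norm_mult)
    also have "\<dots> \<le> ?B + ?B"
      by (intro add_mono order_trans[OF norm_le_mat_max] Q1 Q2)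
    finally show "norm (QC x k $ i $ j) \<le> 2 * b * iwt k powr - s" by simp
  qed
qed

lemma conv_eq: "conv a x k = (\<Sum>\<^sub>\<infinity>l. a l ** QC x (k - l))"
  unfolding conv_def
  by (rule infsum_reindex_bij_witness[where i = "\<lambda>l. (l, k - l)" and j = fst]) auto

text \<open>The cube of the dimension combines a square, from comparing \<open>norm\<close> with
  \<open>mat_max\<close>, and one factor from the matrix product. The 2 comes from real and
  imaginary parts, \<open>2 powr s\<close> from \<open>iwt_triangle\<close>.\<close>

lemma conv_term_bound:
  fixes a :: "int \<Rightarrow> complex^'n^'n"
  assumes "coeff_bound s \<alpha> a" "seq_norm s x \<le> ereal b" "s \<ge> 0"
  shows "norm (a l ** QC x (k - l)) \<le> (2 * real CARD('n) ^ 3 * 2 powr s * \<alpha> * b * iwt k powr - s) *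
           (iwt l powr - s + iwt (k - l) powr - s)"
proof -
  have b: "0 \<le> b" by (rule seq_norm_imp_nonneg[OF assms(2)])
  have "norm (a l ** QC x (k - l)) \<le> (real CARD('n))\<^sup>2 * (real CARD('n) * mat_max (a l) * mat_max (QC x (k - l)))"
    by (rule order_trans[OF norm_le_mat_max_card]) (intro mult_left_mono mat_max_mult, simp)
  also have "\<dots> \<le> (real CARD('n))\<^sup>2 * (real CARD('n) * (\<alpha> * iwt l powr - s) * (2 * b * iwt (k - l) powr - s))"
    using assms b by (intro mult_left_mono mult_mono mat_max_QC) (auto simp: coeff_bound_def)
  also have "\<dots> = (2 * real CARD('n) ^ 3 * \<alpha> * b) * (iwt l powr - s * iwt (k - l) powr - s)"
    by (simp add: power2_eq_square power3_eq_cube)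
  also have "\<dots> \<le> (2 * real CARD('n) ^ 3 * \<alpha> * b) * (2 powr s * iwt k powr - s * (iwt l powr - s + iwt (k - l) powr - s))"
    using assms b by (intro mult_left_mono iwt_triangle) (auto simp: coeff_bound_def)
  finally show ?thesis by (simp add: mult_ac)
qed

text \<open>The map taking \<open>l\<close> to \<open>k - l\<close> is an involution of the
  integers.\<close>

lemma summable_iwt_shift:
  assumes "s > 1"
  shows "(\<lambda>l. iwt (k - l) powr - s) summable_on UNIV"
    and "(\<Sum>\<^sub>\<infinity>l. iwt (k - l) powr - s) = (\<Sum>\<^sub>\<infinity>l. iwt l powr - s)"
proof -
  have bij: "bij_betw (\<lambda>l. k - l) UNIV UNIV"
    by (rule bij_betwI[where g = "\<lambda>l. k - l"]) auto
  show "(\<lambda>l. iwt (k - l) powr - s) summable_on UNIV"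
    using summable_on_reindex_bij_betw[OF bij, of "\<lambda>l. iwt l powr - s"] summable_iwt[OF assms] by simp
  show "(\<Sum>\<^sub>\<infinity>l. iwt (k - l) powr - s) = (\<Sum>\<^sub>\<infinity>l. iwt l powr - s)"
    by (rule infsum_reindex_bij_betw[OF bij])
qed

lemma conv_abs_summable:
  assumes "coeff_bound s \<alpha> a" "x \<in> Omega s" "s > 1"
  shows "(\<lambda>l. norm (a l ** QC x (k - l))) summable_on UNIV"
proof -
  obtain b where b: "seq_norm s x \<le> ereal b" using assms(2) Omega_iff by blast
  from assms(3) have "s \<ge> 0" by simp
  note le = conv_term_bound[OF assms(1) b this]
  show ?thesis
  proof (rule Infinite_Sum.abs_summable_on_comparison_test')
    show "norm (a l ** QC x (k - l)) \<le> (2 * real CARD('a) ^ 3 * 2 powr s * \<alpha> * b * iwt k powr - s) *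
        (iwt l powr - s + iwt (k - l) powr - s)" for l
      by (rule le)
  qed (intro summable_on_cmult_right summable_on_add summable_iwt summable_iwt_shift assms)
qed

text \<open>Convolution is bounded on Omega with exponent \<open>s\<close>. Both summands in
  \<open>conv_term_bound\<close> have the same sum \<open>\<sigma>\<close>, independent of
  \<open>k\<close>, whence the factor \<open>2 * \<sigma>\<close> in \<open>C\<close>.\<close>

lemma conv_bound:
  fixes a :: "int \<Rightarrow> complex^'n^'n"
  assumes "coeff_bound s \<alpha> a" "s > 1"
  shows "\<exists>C\<ge>0. \<forall>x b k. seq_norm s x \<le> ereal b \<longrightarrow> mat_max (conv a x k) \<le> C * b * iwt k powr - s"
proof -
  define \<sigma> where "\<sigma> = (\<Sum>\<^sub>\<infinity>l. iwt l powr - s)"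
  have \<sigma>: "\<sigma> \<ge> 0" unfolding \<sigma>_def by (intro infsum_nonneg) auto
  define C where "C = 2 * real CARD('n) ^ 3 * 2 powr s * \<alpha> * (2 * \<sigma>)"
  have "mat_max (conv a x k) \<le> C * b * iwt k powr - s" if b: "seq_norm s x \<le> ereal b" for x b k
  proof -
    have x: "x \<in> Omega s" using b Omega_iff by blast
    let ?B = "2 * real CARD('n) ^ 3 * 2 powr s * \<alpha> * b * iwt k powr - s"
    have sm: "(\<lambda>l. iwt l powr - s + iwt (k - l) powr - s) summable_on UNIV"
      using assms(2) by (intro summable_on_add summable_iwt summable_iwt_shift)
    have "mat_max (conv a x k) \<le> norm (conv a x k)" by (rule mat_max_le_norm)
    also have "\<dots> \<le> (\<Sum>\<^sub>\<infinity>l. norm (a l ** QC x (k - l)))"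
      unfolding conv_eq by (intro norm_infsum_bound conv_abs_summable[OF assms(1) x assms(2)])
    also have "\<dots> \<le> (\<Sum>\<^sub>\<infinity>l. ?B * (iwt l powr - s + iwt (k - l) powr - s))"
      using assms(2) by (intro infsum_mono conv_abs_summable[OF assms(1) x] conv_term_bound[OF assms(1) b]
        summable_on_cmult_right sm) auto
    also have "\<dots> = ?B * (\<Sum>\<^sub>\<infinity>l. iwt l powr - s + iwt (k - l) powr - s)"
      by (rule infsum_cmult_right') 
    also have "(\<Sum>\<^sub>\<infinity>l. iwt l powr - s + iwt (k - l) powr - s) = \<sigma> + \<sigma>"
      using assms(2) by (subst infsum_add) (auto simp: \<sigma>_def summable_iwt summable_iwt_shift)
    finally show ?thesis by (simp add: C_def mult_ac)
  qed
  moreover have "C \<ge> 0" using assms \<sigma> by (auto simp: C_def coeff_bound_def)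
  ultimately show ?thesis by blast
qed

lemma QC_add: "QC (\<lambda>k. x k + y k) k = QC x k + QC y k"
  by (auto simp: QC_def Q1_def Q2_def vec_eq_iff algebra_simps)

lemma QC_scaleR: "QC (\<lambda>k. c *\<^sub>R x k) k = c *\<^sub>R QC x k"
  by (auto simp: QC_def Q1_def Q2_def vec_eq_iff complex_eq_iff)

lemma conv_add:
  assumes "coeff_bound s \<alpha> a" "s > 1" "x \<in> Omega s" "y \<in> Omega s"
  shows "conv a (\<lambda>k. x k + y k) k = conv a x k + conv a y k"
  unfolding conv_eq QC_add matrix_add_ldistrib
  using conv_abs_summable[OF assms(1) _ assms(2), THEN abs_summable_summable] assms(3,4)
  by (intro infsum_add) simp_all

lemma conv_scaleR: "conv a (\<lambda>k. c *\<^sub>R x k) k = c *\<^sub>R conv a x k"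
  unfolding conv_eq QC_scaleR matrix_scalar_ac scalar_matrix_assoc[symmetric] by (rule infsum_scaleR_right)

section \<open>Differentiability of \<open>T\<close>\<close>

text \<open>\<open>fmap\<close> without the identity matrix in its first component and without the
  products with \<open>R\<close>.\<close>

definition fmap_lin :: "real \<Rightarrow> (int \<Rightarrow> complex^'n^'n) \<Rightarrow> 'n seqX \<Rightarrow> 'n seqX" where
  "fmap_lin \<tau> a x k =
    (if k = 0 then
       (snd (x 0) + 2 *\<^sub>R (\<Sum>\<^sub>\<infinity>l\<in>{1..}. fst (x l)), - map_matrix Re (conv a x 0))
     else
       (- (real k * (2 * pi / (2 * \<tau>))) *\<^sub>R snd (x k) - map_matrix Re (conv a x (int k)),
        (real k * (2 * pi / (2 * \<tau>))) *\<^sub>R fst (x k) - map_matrix Im (conv a x (int k))))"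

text \<open>Polarised form of the products with \<open>R\<close>: \<open>x\<close> supplies the left
  factor and \<open>y\<close> supplies \<open>R\<close>. The conditional covers only the first
  component, since at index 0 that slot is f_star, which has no product.\<close>

definition fmap_bil :: "('n::finite) seqX \<Rightarrow> 'n seqX \<Rightarrow> 'n seqX" where
  "fmap_bil x y k = (if k = 0 then 0 else fst (x k) ** fst (y 0), snd (x k) ** fst (y 0))"

lemma fmap_decomp:
  "fmap \<tau> a x k = fmap_lin \<tau> a x k + fmap_bil x x k - (if k = 0 then (mat 1, 0) else 0)"
  by (simp add: fmap_def fmap_lin_def fmap_bil_def Let_def)

lemma matrix_add_rdistrib: "(A + B) ** C = A ** C + B ** C"
  by (simp add: matrix_matrix_mult_def vec_eq_iff sum.distrib distrib_right)

lemma fmap_bil_add_left: "fmap_bil (\<lambda>k. x k + y k) z k = fmap_bil x z k + fmap_bil y z k"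
  by (simp add: fmap_bil_def matrix_add_rdistrib)

lemma fmap_bil_add_right: "fmap_bil z (\<lambda>k. x k + y k) k = fmap_bil z x k + fmap_bil z y k"
  by (simp add: fmap_bil_def matrix_add_ldistrib)

lemma fmap_bil_scaleR_left: "fmap_bil (\<lambda>k. c *\<^sub>R x k) z k = c *\<^sub>R fmap_bil x z k"
  by (simp add: fmap_bil_def scalar_matrix_assoc)

lemma fmap_bil_scaleR_right: "fmap_bil z (\<lambda>k. c *\<^sub>R x k) k = c *\<^sub>R fmap_bil z x k"
  by (simp add: fmap_bil_def matrix_scalar_ac scalar_matrix_assoc)

lemma seq_norm_le_smaller_exponent:
  assumes "s' \<le> s" "seq_norm s x \<le> e"
  shows "seq_norm s' x \<le> e"
proof -
  have "seq_norm s' x \<le> seq_norm s x"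
    unfolding seq_norm_def using assms(1) by (intro SUP_mono') (auto intro!: mult_left_mono powr_mono)
  with assms(2) show ?thesis by (rule order_trans[rotated])
qed

text \<open>\<open>R\<close> sits at index 0, where the weight is 1, so multiplying by it keeps the
  decay of \<open>x\<close>.\<close>

lemma fmap_bil_bound:
  fixes x y :: "('n::finite) seqX"
  assumes x: "seq_norm s x \<le> ereal b" and y: "seq_norm s y \<le> ereal c"
  shows "seq_norm s (fmap_bil x y) \<le> ereal (real CARD('n) * b * c)"
  unfolding seq_norm_le_iff'
proof
  fix k
  have y0: "mat_max (fst (y 0)) \<le> c"
    using order_trans[OF mat_max_fst_le, of "y 0" c] y[unfolded seq_norm_le_iff', rule_format, of 0]
    by (simp add: wt_def)
  have xk: "mat2_max (x k) \<le> b * wt k powr - s" using x by (simp add: seq_norm_le_iff')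
  have *: "mat_max (A ** fst (y 0)) \<le> real CARD('n) * b * c * wt k powr - s"
    if "mat_max A \<le> b * wt k powr - s" for A
  proof -
    have "mat_max (A ** fst (y 0)) \<le> real CARD('n) * mat_max A * mat_max (fst (y 0))"
      by (rule mat_max_mult)
    also have "\<dots> \<le> real CARD('n) * (b * wt k powr - s) * c"
      using that y0 seq_norm_imp_nonneg[OF x] by (intro mult_mono mult_left_mono) auto
    finally show ?thesis by (simp add: mult_ac)
  qed
  have "0 \<le> real CARD('n) * b * c * wt k powr - s"
    using seq_norm_imp_nonneg[OF x] seq_norm_imp_nonneg[OF y] by simp
  then show "mat2_max (fmap_bil x y k) \<le> real CARD('n) * b * c * wt k powr - s"
    using *[OF order_trans[OF mat_max_fst_le xk]] *[OF order_trans[OF mat_max_snd_le xk]]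
    by (cases "k = 0") (simp_all add: fmap_bil_def mat2_max_def)
qed

lemma fst_abs_summable:
  fixes x :: "('n::finite) seqX"
  assumes "seq_norm s x \<le> ereal b" "s > 1"
  shows "(\<lambda>l. norm (fst (x l))) summable_on {1..}"
    and "(\<Sum>\<^sub>\<infinity>l\<in>{1..}. norm (fst (x l))) \<le> (real CARD('n))\<^sup>2 * b * (\<Sum>\<^sub>\<infinity>l\<in>{1..}. wt l powr - s)"
proof -
  have sm: "(\<lambda>l. wt l powr - s) summable_on {1..}"
    by (rule summable_on_subset_banach[OF summable_wt[OF assms(2)]]) auto
  have le: "norm (fst (x l)) \<le> (real CARD('n))\<^sup>2 * b * wt l powr - s" for l
  proof -
    have "norm (fst (x l)) \<le> (real CARD('n))\<^sup>2 * mat_max (fst (x l))" by (rule norm_le_mat_max_card)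
    also have "\<dots> \<le> (real CARD('n))\<^sup>2 * (b * wt l powr - s)"
      using assms(1) by (intro mult_left_mono order_trans[OF mat_max_fst_le]) (auto simp: seq_norm_le_iff')
    finally show ?thesis by simp
  qed
  show *: "(\<lambda>l. norm (fst (x l))) summable_on {1..}"
  proof (rule Infinite_Sum.abs_summable_on_comparison_test')
    show "norm (fst (x l)) \<le> (real CARD('n))\<^sup>2 * b * wt l powr - s" for l by (rule le)
  qed (intro summable_on_cmult_right sm)
  have "(\<Sum>\<^sub>\<infinity>l\<in>{1..}. norm (fst (x l))) \<le> (\<Sum>\<^sub>\<infinity>l\<in>{1..}. (real CARD('n))\<^sup>2 * b * wt l powr - s)"
    by (intro infsum_mono * le summable_on_cmult_right sm)
  also have "\<dots> = (real CARD('n))\<^sup>2 * b * (\<Sum>\<^sub>\<infinity>l\<in>{1..}. wt l powr - s)"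
    by (rule infsum_cmult_right')
  finally show "(\<Sum>\<^sub>\<infinity>l\<in>{1..}. norm (fst (x l))) \<le> (real CARD('n))\<^sup>2 * b * (\<Sum>\<^sub>\<infinity>l\<in>{1..}. wt l powr - s)" .
qed

text \<open>The frequency factor \<open>k\<close> costs one power of the weight, hence the target
  exponent \<open>s - 1\<close>.\<close>

lemma fmap_lin_bound:
  fixes a :: "int \<Rightarrow> complex^'n^'n"
  assumes a: "coeff_bound s \<alpha> a" and s: "s > 1"
  shows "\<exists>C\<ge>0. \<forall>x b. seq_norm s x \<le> ereal b \<longrightarrow> seq_norm (s - 1) (fmap_lin \<tau> a x) \<le> ereal (C * b)"
proof -
  obtain C where C: "C \<ge> 0" "\<And>x b k. seq_norm s x \<le> ereal b \<Longrightarrow> mat_max (conv a x k) \<le> C * b * iwt k powr - s"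
    using conv_bound[OF a s] by blast
  define \<sigma> where "\<sigma> = (\<Sum>\<^sub>\<infinity>l\<in>{1..}. wt l powr - s)"
  have \<sigma>: "\<sigma> \<ge> 0" unfolding \<sigma>_def by (intro infsum_nonneg) auto
  define p where "p = \<bar>2 * pi / (2 * \<tau>)\<bar>"
  have p: "p \<ge> 0" by (simp add: p_def)
  \<comment> \<open>The summands account for \<open>Q0\<close>, the infinite series in f_star, the
    convolution and the frequency factor.\<close>
  define C' where "C' = 1 + 2 * (real CARD('n))\<^sup>2 * \<sigma> + C + p"
  have "seq_norm (s - 1) (fmap_lin \<tau> a x) \<le> ereal (C' * b)" if x: "seq_norm s x \<le> ereal b" for x b
    unfolding seq_norm_le_iff'
  proof
    fix k
    have b: "b \<ge> 0" by (rule seq_norm_imp_nonneg[OF x])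
    have xk: "mat2_max (x k) \<le> b * wt k powr - s" for k using x by (simp add: seq_norm_le_iff')
    note f1 = order_trans[OF mat_max_fst_le xk] and f2 = order_trans[OF mat_max_snd_le xk]
    show "mat2_max (fmap_lin \<tau> a x k) \<le> C' * b * wt k powr - (s - 1)"
    proof (cases "k = 0")
      case True
      let ?S = "\<Sum>\<^sub>\<infinity>l\<in>{1..}. fst (x l)"
      have "mat_max ?S \<le> norm ?S" by (rule mat_max_le_norm)
      also have "\<dots> \<le> (\<Sum>\<^sub>\<infinity>l\<in>{1..}. norm (fst (x l)))"
        by (intro norm_infsum_bound fst_abs_summable(1)[OF x s])
      also have "\<dots> \<le> (real CARD('n))\<^sup>2 * b * \<sigma>"
        unfolding \<sigma>_def by (rule fst_abs_summable(2)[OF x s])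
      finally have "mat_max (2 *\<^sub>R ?S) \<le> 2 * ((real CARD('n))\<^sup>2 * b * \<sigma>)"
        using mat_max_scaleR[of 2 ?S] by simp
      then have "mat_max (snd (x 0) + 2 *\<^sub>R ?S) \<le> b + 2 * ((real CARD('n))\<^sup>2 * b * \<sigma>)"
        using mat_max_add[of "snd (x 0)" "2 *\<^sub>R ?S"] f2[of 0] by (simp add: wt_def)
      also have "\<dots> \<le> C' * b" using C(1) p b by (simp add: C'_def algebra_simps)
      finally have 1: "mat_max (snd (x 0) + 2 *\<^sub>R ?S) \<le> C' * b" .
      have "mat_max (map_matrix Re (conv a x 0)) \<le> C * b"
        using order_trans[OF mat_max_Re C(2)[OF x], of 0] by (simp add: iwt_def wt_def)
      also have "\<dots> \<le> C' * b" using \<sigma> p b by (intro mult_right_mono) (auto simp: C'_def)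
      finally show ?thesis using 1 True by (simp add: fmap_lin_def mat2_max_def wt_def)
    next
      case False
      have pw: "wt k powr - (s - 1) = real k * wt k powr - s"
        using False powr_add[of "wt k" 1 "- s"] by (simp add: wt_def)
      have k: "1 \<le> real k" using False by simp
      have *: "mat_max (c *\<^sub>R X - E) \<le> C' * b * wt k powr - (s - 1)"
        if "\<bar>c\<bar> = real k * p" "mat_max X \<le> b * wt k powr - s" "mat_max E \<le> C * b * wt k powr - s" for c X E
      proof -
        have "mat_max (c *\<^sub>R X) \<le> real k * p * mat_max X" using mat_max_scaleR[of c X] that by simp
        also have "\<dots> \<le> real k * p * (b * wt k powr - s)" using that p by (intro mult_left_mono) auto
        finally have "mat_max (c *\<^sub>R X - E) \<le> real k * p * (b * wt k powr - s) + 1 * (C * b * wt k powr - s)"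
          using mat_max_diff[of "c *\<^sub>R X" E] that by simp
        \<comment> \<open>The convolution decays better than required; as \<open>k\<close> is at
          least 1 it is weakened to the rate of the frequency term.\<close>
        also have "\<dots> \<le> real k * p * (b * wt k powr - s) + real k * (C * b * wt k powr - s)"
          using k C(1) b by (intro add_left_mono mult_right_mono) auto
        also have "\<dots> = (p + C) * (b * (real k * wt k powr - s))" by (simp add: algebra_simps)
        also have "\<dots> \<le> C' * (b * (real k * wt k powr - s))"
          using \<sigma> b by (intro mult_right_mono) (auto simp: C'_def)
        finally show ?thesis unfolding pw by (simp add: mult_ac)
      qed
      have ck: "mat_max (conv a x (int k)) \<le> C * b * wt k powr - s" using C(2)[OF x, of "int k"] by simp
      have "mat_max (- (real k * (2 * pi / (2 * \<tau>))) *\<^sub>R snd (x k) - map_matrix Re (conv a x (int k)))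
          \<le> C' * b * wt k powr - (s - 1)"
        by (rule *[OF _ f2 order_trans[OF mat_max_Re ck]]) (simp add: p_def abs_mult)
      moreover have "mat_max ((real k * (2 * pi / (2 * \<tau>))) *\<^sub>R fst (x k) - map_matrix Im (conv a x (int k)))
          \<le> C' * b * wt k powr - (s - 1)"
        by (rule *[OF _ f1 order_trans[OF mat_max_Im ck]]) (simp add: p_def abs_mult)
      ultimately show ?thesis using False by (simp add: fmap_lin_def mat2_max_def)
    qed
  qed
  moreover have "C' \<ge> 0" using C(1) \<sigma> p by (simp add: C'_def)
  ultimately show ?thesis by blast
qed

lemma fmap_lin_add:
  assumes "coeff_bound s \<alpha> a" "s > 1" "x \<in> Omega s" "y \<in> Omega s"
  shows "fmap_lin \<tau> a (\<lambda>k. x k + y k) k = fmap_lin \<tau> a x k + fmap_lin \<tau> a y k"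
proof -
  have sm: "(\<lambda>l. fst (x l)) summable_on {1..}" if x: "x \<in> Omega s" for x :: "'a seqX"
    using x fst_abs_summable(1)[OF _ assms(2), THEN abs_summable_summable] unfolding Omega_iff by blast
  have *: "(\<Sum>\<^sub>\<infinity>l\<in>{Suc 0..}. fst (x l) + fst (y l)) = (\<Sum>\<^sub>\<infinity>l\<in>{Suc 0..}. fst (x l)) + (\<Sum>\<^sub>\<infinity>l\<in>{Suc 0..}. fst (y l))"
    using sm assms by (intro infsum_add) simp_all
  have mm: "map_matrix Re (A + B) = map_matrix Re A + map_matrix Re B"
    "map_matrix Im (A + B) = map_matrix Im A + map_matrix Im B" for A B :: "complex^'a^'a"
    by (simp_all add: vec_eq_iff)
  show ?thesis
    using * by (simp add: fmap_lin_def mm conv_add[OF assms] algebra_simps)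
qed

lemma fmap_lin_scaleR: "fmap_lin \<tau> a (\<lambda>k. c *\<^sub>R x k) k = c *\<^sub>R fmap_lin \<tau> a x k"
proof -
  have mm: "map_matrix Re (c *\<^sub>R A) = c *\<^sub>R map_matrix Re A"
    "map_matrix Im (c *\<^sub>R A) = c *\<^sub>R map_matrix Im A" for A :: "complex^'a^'a"
    by (simp_all add: vec_eq_iff)
  show ?thesis
    by (simp add: fmap_lin_def infsum_scaleR_right mm conv_scaleR algebra_simps)
qed

section \<open>The operator A: linearity, smoothing and injectivity\<close>

lemma mat2_of_add: "mat2_of (u + v) = mat2_of u + mat2_of v"
  by (simp add: mat2_of_def prod_eq_iff vec_eq_iff)

lemma mat2_of_scaleR: "mat2_of (c *\<^sub>R v) = c *\<^sub>R mat2_of v"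
  by (simp add: mat2_of_def prod_eq_iff vec_eq_iff)

lemma Aop_add: "Aop \<tau> a m Am xbar (\<lambda>k. x k + y k) k = Aop \<tau> a m Am xbar x k + Aop \<tau> a m Am xbar y k"
  by (simp add: Aop_def vec_of_add matrix_vector_right_distrib sum.distrib mat2_of_add)

lemma Aop_scaleR: "Aop \<tau> a m Am xbar (\<lambda>k. c *\<^sub>R x k) k = c *\<^sub>R Aop \<tau> a m Am xbar x k"
  by (simp add: Aop_def vec_of_scaleR matrix_vector_mult_scaleR mat2_of_scaleR flip: scaleR_right.sum)

lemma row_sum_norm_bound: "\<bar>(B *v vec_of P) $ c\<bar> \<le> row_sum_norm B * mat2_max P"
proof -
  have "\<bar>(B *v vec_of P) $ c\<bar> \<le> (\<Sum>j\<in>UNIV. \<bar>B $ c $ j * vec_of P $ j\<bar>)"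
    unfolding matrix_vector_mult_def by (simp add: sum_abs)
  also have "\<dots> \<le> (\<Sum>j\<in>UNIV. \<bar>B $ c $ j\<bar> * mat2_max P)"
    by (intro sum_mono) (auto simp: abs_mult intro!: mult_left_mono abs_vec_of_le)
  also have "\<dots> = (\<Sum>j\<in>UNIV. \<bar>B $ c $ j\<bar>) * mat2_max P" by (simp add: sum_distrib_right)
  also have "\<dots> \<le> row_sum_norm B * mat2_max P"
    unfolding row_sum_norm_def by (intro mult_right_mono Max_ge) auto
  finally show ?thesis .
qed

lemma row_sum_norm_nonneg: "0 \<le> row_sum_norm B"
  unfolding row_sum_norm_def by (rule Max_ge_iff[THEN iffD2]) (auto intro!: sum_nonneg)

text \<open>A regains the power lost by f: in the tail through the decay of the inverses of
  \<open>Lam\<close>, and in the first \<open>m\<close> components because only finitely many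
  weights occur there.\<close>

lemma Aop_bound:
  fixes Am :: "('n::finite) blockmat" and xbar :: "'n seqX"
  assumes m: "m > 0" and s: "s \<ge> 1"
    and \<Lambda>: "\<And>k. k \<ge> m \<Longrightarrow> row_sum_norm (matrix_inv (Lam \<tau> a xbar k)) \<le> C\<Lambda> / real k"
  shows "\<exists>C\<ge>0. \<forall>x b. seq_norm (s - 1) x \<le> ereal b \<longrightarrow> seq_norm s (Aop \<tau> a m Am xbar x) \<le> ereal (C * b)"
proof -
  \<comment> \<open>Summing over the rows as well gives one constant for all of them; the factor
    \<open>wt k powr s\<close> pays for the weight required at index \<open>k\<close>.\<close>
  define S where "S = (\<Sum>k<m. \<Sum>l<m. row_sum_norm (Am k l) * wt k powr s)"
  have S: "S \<ge> 0" unfolding S_def by (intro sum_nonneg mult_nonneg_nonneg row_sum_norm_nonneg) auto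
  \<comment> \<open>The bound at \<open>k = m\<close> dominates a nonnegative norm, which forces the
    sign of \<open>C\<Lambda>\<close>.\<close>
  have "0 \<le> C\<Lambda> / real m" using \<Lambda>[of m] row_sum_norm_nonneg order_trans by blast
  then have C\<Lambda>: "C\<Lambda> \<ge> 0" using m by (simp add: zero_le_divide_iff)
  have "seq_norm s (Aop \<tau> a m Am xbar x) \<le> ereal ((S + C\<Lambda>) * b)" if x: "seq_norm (s - 1) x \<le> ereal b" for x b
    unfolding seq_norm_le_iff' mat2_max_le_iff
  proof (intro allI)
    fix k c
    have b: "b \<ge> 0" by (rule seq_norm_imp_nonneg[OF x])
    have xk: "mat2_max (x k) \<le> b * wt k powr - (s - 1)" for k using x by (simp add: seq_norm_le_iff')
    show "\<bar>vec_of (Aop \<tau> a m Am xbar x k) $ c\<bar> \<le> (S + C\<Lambda>) * b * wt k powr - s"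
    proof (cases "k < m")
      case True
      have xb: "mat2_max (x l) \<le> b" for l
      proof -
        have "wt l powr - (s - 1) \<le> wt l powr 0" using s by (intro powr_mono) auto
        then have "b * wt l powr - (s - 1) \<le> b * 1" using b by (intro mult_left_mono) auto
        then show ?thesis using xk[of l] by linarith
      qed
      have "\<bar>vec_of (Aop \<tau> a m Am xbar x k) $ c\<bar> \<le> (\<Sum>l<m. \<bar>(Am k l *v vec_of (x l)) $ c\<bar>)"
        using True by (simp add: Aop_def)
      also have "\<dots> \<le> (\<Sum>l<m. row_sum_norm (Am k l) * b)"
        by (intro sum_mono order_trans[OF row_sum_norm_bound] mult_left_mono xb row_sum_norm_nonneg)
      also have "\<dots> = (\<Sum>l<m. row_sum_norm (Am k l) * wt k powr s) * (b * wt k powr - s)"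
        unfolding sum_distrib_right by (intro sum.cong) (simp_all add: powr_minus)
      also have "\<dots> \<le> S * (b * wt k powr - s)"
        unfolding S_def using True b
        by (intro mult_right_mono member_le_sum sum_nonneg mult_nonneg_nonneg row_sum_norm_nonneg) auto
      also have "\<dots> \<le> (S + C\<Lambda>) * (b * wt k powr - s)"
        using b C\<Lambda> by (intro mult_right_mono) auto
      finally show ?thesis by simp
    next
      case False
      then have k: "real k > 0" "wt k = real k" using m by (auto simp: wt_def)
      have pw: "wt k powr - (s - 1) = real k * wt k powr - s"
        using k powr_add[of "wt k" 1 "- s"] by simp
      have "\<bar>vec_of (Aop \<tau> a m Am xbar x k) $ c\<bar> \<le> row_sum_norm (matrix_inv (Lam \<tau> a xbar k)) * mat2_max (x k)"
        using False by (simp add: Aop_def row_sum_norm_bound)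
      also have "\<dots> \<le> C\<Lambda> / real k * (b * wt k powr - (s - 1))"
        using False C\<Lambda> by (intro mult_mono \<Lambda> xk) auto
      also have "\<dots> = C\<Lambda> * (b * wt k powr - s)" unfolding pw using k(1) by simp
      also have "\<dots> \<le> (S + C\<Lambda>) * (b * wt k powr - s)"
        using b S by (intro mult_right_mono) auto
      finally show ?thesis by simp
    qed
  qed
  then show ?thesis using S C\<Lambda> by (intro exI[of _ "S + C\<Lambda>"]) auto
qed

lemma matrix_inv_right:
  fixes A :: "real^'n^'n"
  assumes "invertible A"
  shows "A ** matrix_inv A = mat 1"
  using someI_ex[OF assms[unfolded invertible_def]] by (simp add: matrix_inv_def)

text \<open>Injectivity of A, which separates into the finite block and the single tail
  components.\<close>

lemma Aop_eq_zero_imp: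
  fixes Am :: "('n::finite) blockmat"
  assumes inv: "block_invertible m Am"
    and \<Lambda>: "\<And>k. k \<ge> m \<Longrightarrow> invertible (Lam \<tau> a xbar k)"
    and zero: "\<And>k. Aop \<tau> a m Am xbar x k = 0"
  shows "x k = 0"
proof (cases "k < m")
  case True
  obtain C where C: "block_inverse m Am C" using inv block_invertible_def by blast
  have A: "(\<Sum>l<m. Am j l *v vec_of (x l)) = 0" if "j < m" for j
    using arg_cong[OF zero[of j], of vec_of] that by (simp add: Aop_def)
  have sm: "(\<Sum>j\<in>J. B j) *v v = (\<Sum>j\<in>J. B j *v v)"
    for J :: "nat set" and B :: "nat \<Rightarrow> real^('n idx)^('n idx)" and v
    by (induction J rule: infinite_finite_induct) (auto simp: matrix_vector_mult_add_rdistrib)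
  \<comment> \<open>The identity block is written out so that it can be replaced by the left inverse
    \<open>C\<close> times \<open>Am\<close>.\<close>
  have "vec_of (x k) = (\<Sum>l<m. (if k = l then mat 1 else 0) *v vec_of (x l))"
    using True by (simp add: if_distrib[of "\<lambda>B. B *v _"] cong: if_cong)
  also have "\<dots> = (\<Sum>l<m. (\<Sum>j<m. C k j ** Am j l) *v vec_of (x l))"
    using C True by (intro sum.cong) (auto simp: block_inverse_def)
  also have "\<dots> = (\<Sum>j<m. \<Sum>l<m. C k j *v (Am j l *v vec_of (x l)))"
    unfolding sm by (subst sum.swap) (simp add: matrix_vector_mul_assoc)
  also have "\<dots> = (\<Sum>j<m. C k j *v (\<Sum>l<m. Am j l *v vec_of (x l)))"
    by (simp add: linear_sum[OF matrix_vector_mul_linear])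
  also have "\<dots> = 0" using A by simp
  finally show ?thesis using vec_of_inject[of "x k" 0] by simp
next
  case False
  let ?L = "Lam \<tau> a xbar k"
  have "matrix_inv ?L *v vec_of (x k) = 0"
    using arg_cong[OF zero[of k], of vec_of] False by (simp add: Aop_def)
  then have "?L *v (matrix_inv ?L *v vec_of (x k)) = 0" by simp
  then have "vec_of (x k) = 0"
    using \<Lambda>[of k] False by (simp add: matrix_vector_mul_assoc matrix_inv_right)
  then show ?thesis using vec_of_inject[of "x k" 0] by simp
qed

section \<open>Derivatives of f and T\<close>

definition fmap_deriv :: "real \<Rightarrow> (int \<Rightarrow> complex^'n^'n) \<Rightarrow> 'n seqX \<Rightarrow> 'n seqX \<Rightarrow> 'n seqX" where
  "fmap_deriv \<tau> a x h k = fmap_lin \<tau> a h k + fmap_bil x h k + fmap_bil h x k"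

text \<open>The expansion is exact and stops at second order, because f is affine plus a quadratic
  form.\<close>

lemma fmap_add:
  assumes "coeff_bound s \<alpha> a" "s > 1" "x \<in> Omega s" "h \<in> Omega s"
  shows "fmap \<tau> a (\<lambda>k. x k + h k) k = fmap \<tau> a x k + (fmap_deriv \<tau> a x h k + fmap_bil h h k)"
  unfolding fmap_decomp fmap_deriv_def fmap_lin_add[OF assms] fmap_bil_add_left fmap_bil_add_right
  by (simp add: algebra_simps)

lemma fmap_deriv_bound:
  assumes a: "coeff_bound s \<alpha> a" and s: "s > 1" and x: "x \<in> Omega s"
  shows "\<exists>C\<ge>0. \<forall>h b. seq_norm s h \<le> ereal b \<longrightarrow> seq_norm (s - 1) (fmap_deriv \<tau> a x h) \<le> ereal (C * b)"
proof -
  obtain \<beta> where \<beta>: "seq_norm s x \<le> ereal \<beta>" using x Omega_iff by blast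
  obtain C where C: "C \<ge> 0" "\<And>h b. seq_norm s h \<le> ereal b \<Longrightarrow> seq_norm (s - 1) (fmap_lin \<tau> a h) \<le> ereal (C * b)"
    using fmap_lin_bound[OF a s] by blast
  let ?n = "real CARD('a)"
  have "seq_norm (s - 1) (fmap_deriv \<tau> a x h) \<le> ereal ((C + 2 * ?n * \<beta>) * b)" if h: "seq_norm s h \<le> ereal b" for h b
  proof -
    have "seq_norm (s - 1) (fmap_deriv \<tau> a x h)
        \<le> seq_norm (s - 1) (fmap_lin \<tau> a h) + seq_norm (s - 1) (fmap_bil x h) + seq_norm (s - 1) (fmap_bil h x)"
      unfolding fmap_deriv_def by (intro order_trans[OF seq_norm_add] add_right_mono seq_norm_add)
    also have "\<dots> \<le> ereal (C * b) + ereal (?n * \<beta> * b) + ereal (?n * b * \<beta>)"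
      by (intro add_mono C(2) h seq_norm_le_smaller_exponent[of "s - 1" s, OF _ fmap_bil_bound] \<beta>) auto
    finally show ?thesis by (simp add: algebra_simps)
  qed
  moreover have "C + 2 * ?n * \<beta> \<ge> 0" using C(1) seq_norm_imp_nonneg[OF \<beta>] by simp
  ultimately show ?thesis by blast
qed

lemma fmap_deriv_add:
  assumes "coeff_bound s \<alpha> a" "s > 1" "g \<in> Omega s" "h \<in> Omega s"
  shows "fmap_deriv \<tau> a x (\<lambda>k. g k + h k) = (\<lambda>k. fmap_deriv \<tau> a x g k + fmap_deriv \<tau> a x h k)"
  unfolding fmap_deriv_def fmap_lin_add[OF assms] fmap_bil_add_left fmap_bil_add_right
  by (simp add: algebra_simps)

lemma fmap_deriv_scaleR:
  "fmap_deriv \<tau> a x (\<lambda>k. c *\<^sub>R h k) = (\<lambda>k. c *\<^sub>R fmap_deriv \<tau> a x h k)"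
  unfolding fmap_deriv_def fmap_lin_scaleR fmap_bil_scaleR_left fmap_bil_scaleR_right
  by (simp add: algebra_simps)

text \<open>The bound on the derivative of f lands in exponent \<open>s - 1\<close> and A brings it
  back to \<open>s\<close>. By \<open>fmap_add\<close> the remainder is minus A applied to
  \<open>fmap_bil h h\<close>, which is quadratic in the norm of \<open>h\<close>.\<close>

lemma Tmap_has_Omega_derivative:
  fixes Am :: "('n::finite) blockmat"
  assumes a: "coeff_bound s \<alpha> a" and s: "s > 1" and x: "x \<in> Omega s" and m: "m > 0"
    and \<Lambda>: "\<And>k. k \<ge> m \<Longrightarrow> row_sum_norm (matrix_inv (Lam \<tau> a xbar k)) \<le> C\<Lambda> / real k"
  shows "has_Omega_derivative s (Tmap \<tau> a m Am xbar)
           (\<lambda>h k. h k - Aop \<tau> a m Am xbar (fmap_deriv \<tau> a x h) k) x"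
proof -
  let ?A = "Aop \<tau> a m Am xbar" and ?f' = "fmap_deriv \<tau> a x" and ?n = "real CARD('n)"
  obtain C1 where C1: "C1 \<ge> 0" "\<And>h b. seq_norm s h \<le> ereal b \<Longrightarrow> seq_norm (s - 1) (?f' h) \<le> ereal (C1 * b)"
    using fmap_deriv_bound[OF a s x] by blast
  obtain C2 where C2: "C2 \<ge> 0" "\<And>y b. seq_norm (s - 1) y \<le> ereal b \<Longrightarrow> seq_norm s (?A y) \<le> ereal (C2 * b)"
    using Aop_bound[OF m _ \<Lambda>, of s Am] s by auto
  have sub: "seq_norm s (\<lambda>k. h k - y k) \<le> ereal (b + c)"
    if "seq_norm s h \<le> ereal b" "seq_norm s y \<le> ereal c" for h y b c
    using order_trans[OF seq_norm_add[of s h "\<lambda>k. (-1) *\<^sub>R y k"] add_mono[OF that(1) seq_norm_scaleR_le[OF that(2), of "-1"]]]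
    by simp
  have rem: "Tmap \<tau> a m Am xbar (\<lambda>l. x l + h l) k - Tmap \<tau> a m Am xbar x k - (h k - ?A (?f' h) k)
      = (-1) *\<^sub>R ?A (fmap_bil h h) k" if h: "h \<in> Omega s" for h k
  proof -
    have "fmap \<tau> a (\<lambda>k. x k + h k) = (\<lambda>k. fmap \<tau> a x k + (?f' h k + fmap_bil h h k))"
      using fmap_add[OF a s x h] by blast
    then have "?A (fmap \<tau> a (\<lambda>k. x k + h k)) k = ?A (fmap \<tau> a x) k + (?A (?f' h) k + ?A (fmap_bil h h) k)"
      by (simp add: Aop_add)
    then show ?thesis by (simp add: Tmap_def)
  qed
  show ?thesis
    unfolding has_Omega_derivative_def
  proof (intro conjI ballI allI impI)
    fix g h :: "'n seqX" assume "g \<in> Omega s" "h \<in> Omega s"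
    then show "(\<lambda>k. g k + h k - ?A (?f' (\<lambda>k. g k + h k)) k) = (\<lambda>k. g k - ?A (?f' g) k + (h k - ?A (?f' h) k))"
      by (simp add: fmap_deriv_add[OF a s] Aop_add algebra_simps)
  next
    fix c and h :: "'n seqX"
    show "(\<lambda>k. c *\<^sub>R h k - ?A (?f' (\<lambda>k. c *\<^sub>R h k)) k) = (\<lambda>k. c *\<^sub>R (h k - ?A (?f' h) k))"
      by (simp add: fmap_deriv_scaleR Aop_scaleR algebra_simps)
  next
    show "\<exists>C. \<forall>h\<in>Omega s. seq_norm s (\<lambda>k. h k - ?A (?f' h) k) \<le> ereal C * seq_norm s h"
    proof (intro exI ballI)
      fix h :: "'n seqX" assume "h \<in> Omega s"
      then obtain b where b: "0 \<le> b" "seq_norm s h = ereal b" using Omega_seq_norm_real by blast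
      then show "seq_norm s (\<lambda>k. h k - ?A (?f' h) k) \<le> ereal (1 + C2 * C1) * seq_norm s h"
        using sub[OF _ C2(2)[OF C1(2)], of h b h b] by (simp add: algebra_simps)
    qed
  next
    fix \<epsilon> :: real assume \<epsilon>: "\<epsilon> > 0"
    \<comment> \<open>The added 1 makes \<open>C\<close> positive. With radius
      \<open>\<epsilon> / C\<close> one factor \<open>C * b\<close> of the quadratic remainder is at
      most \<open>\<epsilon>\<close>.\<close>
    define C where "C = C2 * ?n + 1"
    have C: "C > 0" using C2(1) by (simp add: C_def add_nonneg_pos)
    show "\<exists>\<delta>>0. \<forall>h\<in>Omega s. seq_norm s h < ereal \<delta> \<longrightarrow>
        seq_norm s (\<lambda>k. Tmap \<tau> a m Am xbar (\<lambda>l. x l + h l) k - Tmap \<tau> a m Am xbar x k - (h k - ?A (?f' h) k))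
        \<le> ereal \<epsilon> * seq_norm s h"
    proof (intro exI[of _ "\<epsilon> / C"] conjI ballI impI)
      show "\<epsilon> / C > 0" using \<epsilon> C by simp
      fix h :: "'n seqX" assume h: "h \<in> Omega s" "seq_norm s h < ereal (\<epsilon> / C)"
      obtain b where b: "0 \<le> b" "seq_norm s h = ereal b" using Omega_seq_norm_real[OF h(1)] by blast
      have bC: "C * b \<le> \<epsilon>" using h(2) b C by (simp add: pos_less_divide_eq mult.commute)
      have "seq_norm (s - 1) (fmap_bil h h) \<le> ereal (?n * b * b)"
        by (rule seq_norm_le_smaller_exponent[of "s - 1" s, OF _ fmap_bil_bound]) (simp_all add: b)
      from seq_norm_scaleR_le[OF C2(2)[OF this], of "-1"]
      have "seq_norm s (\<lambda>k. (-1) *\<^sub>R ?A (fmap_bil h h) k) \<le> ereal (C2 * (?n * b * b))" by simp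
      also have "C2 * (?n * b * b) \<le> (C * b) * b"
        using b by (simp add: C_def algebra_simps)
      also have "\<dots> \<le> \<epsilon> * b" using bC b by (intro mult_right_mono) auto
      finally show "seq_norm s (\<lambda>k. Tmap \<tau> a m Am xbar (\<lambda>l. x l + h l) k - Tmap \<tau> a m Am xbar x k - (h k - ?A (?f' h) k))
        \<le> ereal \<epsilon> * seq_norm s h"
        unfolding rem[OF h(1)] b(2) by simp
    qed
  qed
qed

text \<open>One derivative exhibited explicitly justifies the choice; the properties in
  \<open>has_Omega_derivative\<close> are all that is used of the chosen one.\<close>

lemma Omega_derivative_works:
  assumes "has_Omega_derivative s F D x"
  shows "has_Omega_derivative s F (Omega_derivative s F x) x"
  unfolding Omega_derivative_def by (rule someI[where P = "\<lambda>D. has_Omega_derivative s F D x", OF assms])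

lemma finite_support_in_Omega:
  assumes "\<And>k. k \<ge> m \<Longrightarrow> x k = 0"
  shows "x \<in> Omega s"
proof (rule OmegaI)
  fix k
  show "mat2_max (x k) * wt k powr s \<le> (\<Sum>k<m. mat2_max (x k) * wt k powr s)"
    using assms[of k] by (cases "k < m") (auto intro!: member_le_sum sum_nonneg)
qed

section \<open>The radii polynomial theorem\<close>

theorem theorem2p6:
  fixes \<tau> s sstar C\<Lambda> Yhat r :: real
    and At :: "real \<Rightarrow> real^'n^'n"
    and a :: "int \<Rightarrow> complex^'n^'n"
    and m K M :: nat
    and xbar :: "'n::finite seqX"
    and Am :: "'n blockmat"
    and Y :: "nat \<Rightarrow> 'n mat2"
    and Z :: "nat \<Rightarrow> real \<Rightarrow> 'n mat2"
    and Zhat :: "real \<Rightarrow> real"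
  defines "f \<equiv> fmap \<tau> a"
    and "T \<equiv> Tmap \<tau> a m Am xbar"
    and "DT \<equiv> Omega_derivative s (Tmap \<tau> a m Am xbar)"
  assumes "\<tau> > 0"
    and "\<And>t. At (t + \<tau>) = At t"
    and "fourier_coeffs \<tau> At a"
    and "2 \<le> s" and "s \<le> sstar" and "coeff_norm sstar a < \<infinity>"
    and "m > 1"
    and "\<And>k. k \<ge> m \<Longrightarrow> xbar k = 0"
    and "block_invertible m Am"
    and "m > K"
    and "\<And>k. k \<ge> K \<Longrightarrow> invertible (Lam \<tau> a xbar k) \<and>
               row_sum_norm (matrix_inv (Lam \<tau> a xbar k)) < C\<Lambda> / real k"
    and "M \<ge> 1"
    and "\<And>k. k < M \<Longrightarrow> cw_le (cw_abs (T xbar k - xbar k)) (Y k)"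
    and "\<And>k \<rho>. k < M \<Longrightarrow> \<rho> > 0 \<Longrightarrow>
           cw_le (cw_Sup {cw_abs (DT (\<lambda>l. xbar l + b1 l) b2 k) | b1 b2. b1 \<in> ball0 s \<rho> \<and> b2 \<in> ball0 s \<rho>})
                 (ereal_mat2 (Z k \<rho>))"
    and "\<And>k. k \<ge> M \<Longrightarrow> mat2_max (T xbar k - xbar k) \<le> real M powr s / real k powr s * Yhat"
    and "\<And>k \<rho>. k \<ge> M \<Longrightarrow> \<rho> > 0 \<Longrightarrow>
           (SUP (b1, b2)\<in>ball0 s \<rho> \<times> ball0 s \<rho>. ereal (mat2_max (DT (\<lambda>l. xbar l + b1 l) b2 k)))
             \<le> ereal (real M powr s / real k powr s * Zhat \<rho>)"
    and "\<And>k. k \<ge> M \<Longrightarrow> Y k = (real M powr s / real k powr s * Yhat) *\<^sub>R (ones, ones)"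
    and "\<And>k \<rho>. k \<ge> M \<Longrightarrow> \<rho> > 0 \<Longrightarrow> Z k \<rho> = (real M powr s / real k powr s * Zhat \<rho>) *\<^sub>R (ones, ones)"
    and "r > 0"
    and "\<And>k. k < M \<Longrightarrow> cw_less (radii_poly s Y Z k r) 0"
    and "radii_poly_tail s M Yhat Zhat r < 0"
  shows "\<exists>!x. x \<in> ball_at s xbar r \<and> T x = x \<and> f x = (\<lambda>k. 0)"
proof -
  \<comment> \<open>Finitely many entries suffice for the contraction factor: index \<open>M\<close>
    stands for the whole tail.\<close>
  define S where "S = {.. M} \<times> (UNIV :: 'n idx set)"
  note per = assms(6)[unfolded fourier_coeffs_def]
  have s: "s > 1" using assms(7) by simp
  have sym: "\<And>k. a (- k) = map_matrix cnj (a k)" using per by blast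
  obtain \<alpha> where \<alpha>: "coeff_bound s \<alpha> a" using coeff_bound_exists[OF assms(9,8) sym] by blast
  have xbar: "xbar \<in> Omega s" by (rule finite_support_in_Omega[OF assms(11)])
  have m: "m > 0" using assms(10) by simp
  have \<Lambda>: "invertible (Lam \<tau> a xbar k)" "row_sum_norm (matrix_inv (Lam \<tau> a xbar k)) \<le> C\<Lambda> / real k"
    if "k \<ge> m" for k
    using assms(14)[of k] that assms(13) by (simp_all add: less_imp_le)
  have T: "T = Tmap \<tau> a m Am xbar" and DT: "DT = Omega_derivative s T" and f: "f = fmap \<tau> a"
    by (simp_all add: T_def DT_def f_def)
  have deriv: "has_Omega_derivative s T (DT (\<lambda>k. xbar k + b k)) (\<lambda>k. xbar k + b k)" if "b \<in> ball0 s r" for b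
  proof -
    have "(\<lambda>k. xbar k + b k) \<in> Omega s"
      using that xbar by (auto simp: ball0_def intro: Omega_add)
    then show ?thesis
      unfolding DT T by (rule Omega_derivative_works[OF Tmap_has_Omega_derivative[OF \<alpha> s _ m \<Lambda>(2)]])
  qed
  define \<eta> where "\<eta> k c = vec_of (Y k) $ c" for k c
  define \<zeta> where "\<zeta> k c = vec_of (Z k r) $ c" for k c
  have wtk: "wt k = real k" if "k \<ge> M" for k using that assms(15) by (simp add: wt_def)
  have tail: "\<eta> k c = real M powr s / real k powr s * Yhat" "\<zeta> k c = real M powr s / real k powr s * Zhat r"
    if "k \<ge> M" for k c
    unfolding \<eta>_def \<zeta>_def assms(20)[OF that] assms(21)[OF that assms(22)] vec_of_scaleR
    by (simp_all add: vec_of_ones)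
  have \<eta>: "\<bar>vec_of (T xbar k - xbar k) $ c\<bar> \<le> \<eta> k c" for k c
  proof (cases "k < M")
    case True
    then show ?thesis
      using assms(16)[OF True] by (simp add: cw_le_iff_vec_of vec_of_cw_abs \<eta>_def)
  next
    case False
    then show ?thesis
      using assms(18)[of k] by (simp add: tail mat2_max_le_iff)
  qed
  have \<zeta>: "\<bar>vec_of (DT (\<lambda>k. xbar k + b1 k) b2 k) $ c\<bar> \<le> \<zeta> k c"
    if b: "b1 \<in> ball0 s r" "b2 \<in> ball0 s r" for b1 b2 k c
  proof (cases "k < M")
    case True
    have "vec_of (cw_abs (DT (\<lambda>l. xbar l + b1 l) b2 k)) $ c \<le> vec_of (Z k r) $ c"
      by (rule cw_Sup_le_imp_vec_of[OF assms(17)[OF True assms(22)]]) (use b in blast)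
    then show ?thesis by (simp add: vec_of_cw_abs \<zeta>_def)
  next
    \<comment> \<open>In the tail the supremum is of maximum norms, so each value is compared with
      it directly and an entry with its maximum norm.\<close>
    case False
    have "ereal (mat2_max (DT (\<lambda>l. xbar l + b1 l) b2 k))
       \<le> (SUP (b1, b2)\<in>ball0 s r \<times> ball0 s r. ereal (mat2_max (DT (\<lambda>l. xbar l + b1 l) b2 k)))"
      by (rule SUP_upper2[of "(b1, b2)"]) (use b in auto)
    also have "\<dots> \<le> ereal (real M powr s / real k powr s * Zhat r)"
      using assms(19)[of k r] False assms(22) by simp
    finally show ?thesis using False by (simp add: tail mat2_max_le_iff)
  qed
  have tail_poly: "Yhat + Zhat r < r / real M powr s"
    using assms(24) by (simp add: radii_poly_tail_def wtk)
  have head_poly: "\<eta> k c + \<zeta> k c < r / wt k powr s" if "k < M" for k c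
    using cw_less_imp_vec_of[OF assms(23)[OF that], of c, unfolded radii_poly_def vec_of_add vec_of_diff vec_of_scaleR]
    by (simp add: vec_of_ones \<eta>_def \<zeta>_def)
  have Mpos: "real M powr s > 0" using assms(15) by simp
  have poly: "\<eta> k c + \<zeta> k c < r / wt k powr s" for k c
  proof (cases "k < M")
    case True
    then show ?thesis by (rule head_poly)
  next
    case False
    then have kpos: "real k powr s > 0" using assms(15) by simp
    \<comment> \<open>For \<open>k\<close> at least \<open>M\<close> the required inequality is the
      one at \<open>M\<close> scaled by a positive factor.\<close>
    have "\<eta> k c + \<zeta> k c = real M powr s / real k powr s * (Yhat + Zhat r)"
      using False by (simp add: tail distrib_left)
    also have "\<dots> < real M powr s / real k powr s * (r / real M powr s)"
      using Mpos kpos by (intro mult_strict_left_mono tail_poly) auto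
    also have "\<dots> = r / wt k powr s" using False Mpos by (simp add: wtk)
    finally show ?thesis .
  qed
  \<comment> \<open>Nonnegativity lets \<open>\<eta>\<close> be dropped from \<open>poly\<close>, so
    that \<open>\<zeta>\<close> alone is strictly below the radius.\<close>
  have \<eta>0: "\<eta> k c \<ge> 0" for k c using \<eta>[of k c] by linarith
  \<comment> \<open>The contraction ratio of a single entry. The maximum with \<open>1 / 2\<close>
    in \<open>\<kappa>\<close> keeps the factor positive even if every ratio vanishes.\<close>
  define q where "q = (\<lambda>(k, c). \<zeta> k c * wt k powr s / r)"
  define \<kappa> where "\<kappa> = max (1 / 2) (Max (q ` S))"
  have S: "finite S" "S \<noteq> {}" by (auto simp: S_def)
  have "q p < 1" for p
  proof -
    obtain k c where p: "p = (k, c)" by (cases p)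
    have "\<zeta> k c < r / wt k powr s" using poly[of k c] \<eta>0[of k c] by linarith
    then show ?thesis using assms(22) by (simp add: p q_def pos_less_divide_eq)
  qed
  then have \<kappa>: "0 < \<kappa>" "\<kappa> < 1" using S by (simp_all add: \<kappa>_def)
  have q\<kappa>: "q (k, c) \<le> \<kappa>" for k c
  proof (cases "k \<le> M")
    case True
    then have "q (k, c) \<le> Max (q ` S)" using S by (intro Max_ge) (auto simp: S_def)
    then show ?thesis by (simp add: \<kappa>_def)
  next
    case False
    \<comment> \<open>The weight at \<open>k\<close> cancels the decay of the tail bound, so the
      ratio is constant from \<open>M\<close> on.\<close>
    then have "q (k, c) = q (M, c)"
      using Mpos by (simp add: q_def tail wtk)
    also have "\<dots> \<le> Max (q ` S)" using S by (intro Max_ge) (auto simp: S_def)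
    finally show ?thesis by (simp add: \<kappa>_def)
  qed
  have contr: "\<zeta> k c \<le> \<kappa> * (r / wt k powr s)" for k c
    using q\<kappa>[of k c] assms(22) by (simp add: q_def pos_divide_le_eq pos_le_divide_eq)
  have fixed: "\<exists>!x. x \<in> ball_at s xbar r \<and> T x = x"
    using s assms(22) by (intro radii_fixed_point[OF xbar _ _ \<kappa> deriv \<eta> \<zeta> less_imp_le[OF poly] contr]) auto
  have zero: "f x = (\<lambda>k. 0)" if "T x = x" for x
  proof
    fix k
    \<comment> \<open>A fixed point of \<open>T\<close> satisfies A f(x) = 0, and injectivity of A
      finishes. As this holds for every fixed point, uniqueness carries over unchanged.\<close>
    have "Aop \<tau> a m Am xbar (f x) k = 0" for k
      using fun_cong[OF that, of k] by (simp add: T f Tmap_def)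
    from Aop_eq_zero_imp[OF assms(12) \<Lambda>(1) this] show "f x k = 0" .
  qed
  then show ?thesis using fixed by metis
qed

end
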